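(* Consider the RMDA algorithm (defined in the context). Assume that there is $L$ such that, for $\xi\sim\mathcal D$, $f_\xi$ is almost surely differentiable with $L$-Lipschitz-continuous gradient (so $f$ is also differentiable with $L$-Lipschitz-continuous gradient), and that there is $C\ge 0$ such that $\mathbb E_{\xi_t\sim\mathcal D}\|\nabla f_{\xi_t}(W^{t-1})\|^2\le C$ for all $t$. (1) If $\{\eta_t\}$ satisfies $$\text{(a)}\ \sum_t\beta_t\eta_t\alpha_t^{-1}=\infty,\qquad \text{(b)}\ \sum_t\left(\beta_t\eta_t\alpha_t^{-1}\right)^2<\infty,\qquad \text{(c)}\ \|W^{t+1}-W^t\|\left(\beta_t\eta_t\alpha_t^{-1}\right)^{-1}\to 0\ \text{almost surely},$$ then $\alpha_t^{-1}V^t-\nabla f(W^{t-1})\to 0$ with probability one. (2) Moreover, if $\{W^t\}$ lies in a bounded set, then $$\mathbb E\left\|\alpha_t^{-1}V^t-\nabla f(W^{t-1})\right\|^2\to 0,$$ and this holds even if condition (b) is replaced by the weaker condition $\beta_t\eta_t\alpha_t^{-1}\to 0$ (with (a) and (c) kept).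
   Context: **Problem.** $\mathcal E$ is a Euclidean space with inner product $\langle\cdot,\cdot\rangle$ and induced norm $\|\cdot\|$. $\mathcal D$ is a probability distribution over a space $\Omega$. For $\xi\in\Omega$, $f_\xi:\mathcal E\to\mathbb R$ is a function that is differentiable almost everywhere with gradient $\nabla f_\xi$. Put $f(W):=\mathbb E_{\xi\sim\mathcal D}[f_\xi(W)]$. The regularizer $\psi:\mathcal E\to(-\infty,\infty]$ may be nondifferentiable and nonconvex. **RMDA algorithm.** Given $W^0\in\mathcal E$, learning rates $\eta_t>0$ and factors $c_t\in[0,1]$ ($t\ge 1$), set $V^0=0$, $\alpha_0=0$, and for $t=1,2,\dots$: - $\beta_t=\sqrt t$ and $\alpha_t=\alpha_{t-1}+\beta_t\eta_t$ (so $\alpha_t=\sum_{k=1}^t\beta_k\eta_k$); - draw $\xi_t\sim\mathcal D$ independently of the past and set $V^t=V^{t-1}+\beta_t\eta_t\nabla f_{\xi_t}(W^{t-1})$; - $\tilde W^t\in\operatorname{argmin}_{W}\ \langle V^t,W\rangle+\frac{\beta_t}{2}\|W-W^0\|^2+\alpha_t\psi(W)$; - $W^t=(1-c_t)W^{t-1}+c_t\tilde W^t$. $\mathbb E_{\xi_t\sim\mathcal D}$ denotes expectation over the fresh sample $\xi_t$, with $W^{t-1}$ held fixed (i.e. conditional on the past). "$\{W^t\}$ lies in a bounded set" means there is a fixed (non-random) bounded set $K\subset\mathcal E$ with $W^t\in K$ for all $t$. *)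

theory Defs
  imports "HOL-Probability.Probability"
begin

text \<open>The gradient is only meaningful at points of differentiability; elsewhere the definite
  description below is an unspecified vector.\<close>

definition grad :: "('e::euclidean_space \<Rightarrow> real) \<Rightarrow> 'e \<Rightarrow> 'e" where
  "grad g w = (THE v. GDERIV g w :> v)"

lemma grad_eqI:
  assumes "GDERIV g w :> v"
  shows "grad g w = v"
  unfolding grad_def
proof (rule the_equality)
  show "GDERIV g w :> v" by fact
next
  fix u assume "GDERIV g w :> u"
  then have "(\<lambda>h. h \<bullet> u) = (\<lambda>h. h \<bullet> v)"
    using assms unfolding gderiv_def by (rule has_derivative_unique)
  then have "(u - v) \<bullet> u = (u - v) \<bullet> v"
    by (rule fun_cong)
  then have "(u - v) \<bullet> (u - v) = 0"
    by (simp add: inner_diff_right)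
  then show "u = v"
    by simp
qed

lemma GDERIV_grad:
  assumes "g differentiable (at w)"
  shows "GDERIV g w :> grad g w"
proof -
  obtain g' where g': "(g has_derivative g') (at w)"
    using assms unfolding differentiable_def by blast
  then interpret bounded_linear g'
    by (rule has_derivative_bounded_linear)
  have "g' h = h \<bullet> adjoint g' 1" for h
    using adjoint_works[OF linear_axioms, of h 1] by simp
  then have "g' = (\<lambda>h. h \<bullet> adjoint g' 1)"
    by blast
  with g' have "GDERIV g w :> adjoint g' 1"
    unfolding gderiv_def by simp
  then show ?thesis
    by (simp only: grad_eqI)
qed

definition mean_loss :: "'w measure \<Rightarrow> ('w \<Rightarrow> 'e::euclidean_space \<Rightarrow> real) \<Rightarrow> 'e \<Rightarrow> real" where
  "mean_loss D f w = (\<integral>x. f x w \<partial>D)"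

definition rmda_beta :: "nat \<Rightarrow> real" where
  "rmda_beta t = sqrt (real t)"

primrec rmda_alpha :: "(nat \<Rightarrow> real) \<Rightarrow> nat \<Rightarrow> real" where
  "rmda_alpha \<eta> 0 = 0"
| "rmda_alpha \<eta> (Suc t) = rmda_alpha \<eta> t + rmda_beta (Suc t) * \<eta> (Suc t)"

text \<open>At \<open>t = 0\<close> the following quotient is \<open>0 / 0 = 0\<close>; the algorithm starts at \<open>t = 1\<close>.\<close>

definition rmda_weight :: "(nat \<Rightarrow> real) \<Rightarrow> nat \<Rightarrow> real" where
  "rmda_weight \<eta> t = rmda_beta t * \<eta> t / rmda_alpha \<eta> t"

text \<open>Meant for \<open>t \<ge> 1\<close>; at \<open>t = 0\<close> the truncated index yields \<open>W 0\<close>. Only the limit in \<open>t\<close>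
  is of interest.\<close>

definition rmda_error ::
  "(nat \<Rightarrow> real) \<Rightarrow> ('e::euclidean_space \<Rightarrow> real) \<Rightarrow> (nat \<Rightarrow> 's \<Rightarrow> 'e) \<Rightarrow> (nat \<Rightarrow> 's \<Rightarrow> 'e)
    \<Rightarrow> nat \<Rightarrow> 's \<Rightarrow> 'e" where
  "rmda_error \<eta> g V W t \<omega> = inverse (rmda_alpha \<eta> t) *\<^sub>R V t \<omega> - grad g (W (t - 1) \<omega>)"

text \<open>
  \<open>M\<close> carries the randomness of the whole run and \<open>F t\<close> is the information available after step
  \<open>t\<close>. It may be larger than what the samples generate, so that the choice of a minimizer may
  itself be random. Independence of a fresh sample from the past is independence from \<open>F t\<close>.
  Step \<open>Suc t\<close> is written in terms of step \<open>t\<close>, so the values of \<open>\<eta>\<close>, \<open>c\<close>, \<open>\<xi>\<close> and \<open>Wmin\<close>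
  at \<open>0\<close> play no role. \<open>Wmin t\<close> is the chosen minimizer at step \<open>t\<close>.
\<close>

locale rmda =
  prob_space M + D: prob_space D + filtration "space M" F
  for M :: "'s measure" and D :: "'w measure" and F :: "nat \<Rightarrow> 's measure" +
  fixes f :: "'w \<Rightarrow> 'e::euclidean_space \<Rightarrow> real"
    and \<psi> :: "'e \<Rightarrow> ereal"
    and W0 :: 'e
    and \<eta> :: "nat \<Rightarrow> real"
    and c :: "nat \<Rightarrow> real"
    and \<xi> :: "nat \<Rightarrow> 's \<Rightarrow> 'w"
    and V :: "nat \<Rightarrow> 's \<Rightarrow> 'e"
    and Wmin :: "nat \<Rightarrow> 's \<Rightarrow> 'e"
    and W :: "nat \<Rightarrow> 's \<Rightarrow> 'e"
  assumes loss_ae_differentiable: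
      "\<And>x. x \<in> space D \<Longrightarrow> AE w in lebesgue. f x differentiable (at w)"
    and loss_integrable: "\<And>w. integrable D (\<lambda>x. f x w)"
    and regularizer: "\<And>w. \<psi> w \<noteq> -\<infinity>"
    and learning_rate_pos: "\<And>t. \<eta> (Suc t) > 0"
    and factor_range: "\<And>t. c (Suc t) \<in> {0..1}"
    and past_sub: "\<And>t. sets (F t) \<subseteq> sets M"
    and sample_measurable: "\<And>t. \<xi> (Suc t) \<in> F (Suc t) \<rightarrow>\<^sub>M D"
    and sample_distr: "\<And>t. distr M D (\<xi> (Suc t)) = D"
    and sample_indep_past:
      "\<And>t. indep_set (sets (F t)) {\<xi> (Suc t) -` A \<inter> space M | A. A \<in> sets D}"
    and V_measurable: "\<And>t. V t \<in> borel_measurable (F t)"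
    and Wmin_measurable: "\<And>t. Wmin (Suc t) \<in> borel_measurable (F (Suc t))"
    and V_0: "\<And>\<omega>. \<omega> \<in> space M \<Longrightarrow> V 0 \<omega> = 0"
    and W_0: "\<And>\<omega>. \<omega> \<in> space M \<Longrightarrow> W 0 \<omega> = W0"
    and V_Suc: "\<And>t \<omega>. \<omega> \<in> space M \<Longrightarrow>
      V (Suc t) \<omega> = V t \<omega> + (rmda_beta (Suc t) * \<eta> (Suc t)) *\<^sub>R grad (f (\<xi> (Suc t) \<omega>)) (W t \<omega>)"
    and Wmin_Suc: "\<And>t \<omega>. \<omega> \<in> space M \<Longrightarrow>
      is_arg_min
        (\<lambda>w. ereal (V (Suc t) \<omega> \<bullet> w + rmda_beta (Suc t) / 2 * (norm (w - W0))\<^sup>2)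
              + ereal (rmda_alpha \<eta> (Suc t)) * \<psi> w)
        (\<lambda>_. True) (Wmin (Suc t) \<omega>)"
    and W_Suc: "\<And>t \<omega>. \<omega> \<in> space M \<Longrightarrow>
      W (Suc t) \<omega> = (1 - c (Suc t)) *\<^sub>R W t \<omega> + c (Suc t) *\<^sub>R Wmin (Suc t) \<omega>"

end

theory Submission
  imports Defs
begin

text \<open>
  Put \<open>b\<^sub>k = \<beta>\<^sub>k \<eta>\<^sub>k\<close>. Since \<open>V\<^sup>t\<close> is the sum of \<open>b\<^sub>k\<close> times the stochastic gradients and \<open>\<alpha>\<^sub>t\<close> is
  the sum of the \<open>b\<^sub>k\<close>, the error is a weighted average of the noise (stochastic minus true
  gradient) plus a drift: the weighted average of the true gradients at past iterates minus the
  one at the current iterate. Abel summation turns the drift into a weighted average of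
  quantities that vanish by the Lipschitz bound and (c). The noise terms are orthogonal to the
  past with second moment at most \<open>C\<close>, so the second moment of their average is at most
  \<open>C \<Sum> b\<^sub>k\<^sup>2 / \<alpha>\<^sub>t\<^sup>2\<close>, which tends to \<open>0\<close> as soon as \<open>b\<^sub>t / \<alpha>\<^sub>t\<close> does. Under (b) the series
  of the noise weighted by \<open>b\<^sub>k / \<alpha>\<^sub>k\<close> converges almost surely by Kolmogorov's maximal
  inequality, and Kronecker's lemma applies. For bounded iterates the drift is bounded, so
  dominated convergence handles its second moment.
\<close>

section \<open>Weighted averages\<close>

text \<open>Toeplitz argument: finitely many early terms contribute a fixed amount, later ones at
  most \<open>r / 2\<close> times the total weight, and the diverging total weight absorbs the fixed
  amount. Bounding \<open>norm (u k)\<close> leaves room for terms whose own index is shifted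
  against the weights.\<close>

lemma weighted_sum_vanishes:
  fixes u :: "nat \<Rightarrow> 'a::real_normed_vector" and b z :: "nat \<Rightarrow> real"
  assumes b: "\<And>k. 0 \<le> b k"
    and div: "filterlim (\<lambda>n. \<Sum>k<n. b k) at_top sequentially"
    and u: "\<And>k. norm (u k) \<le> b k * z k"
    and z: "z \<longlonglongrightarrow> 0"
  shows "(\<lambda>n. (\<Sum>k<n. u k) /\<^sub>R (\<Sum>k<n. b k)) \<longlonglongrightarrow> 0"
proof (rule LIMSEQ_I)
  fix r :: real assume "r > 0"
  then obtain N where N: "\<And>k. k \<ge> N \<Longrightarrow> norm (z k) < r / 2"
    using LIMSEQ_D[OF z, of "r / 2"] by auto
  define K where "K = (\<Sum>k<N. b k * \<bar>z k\<bar>)"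
  have K: "K \<ge> 0"
    unfolding K_def using b by (intro sum_nonneg) simp
  have bound: "norm (\<Sum>k<n. u k) \<le> K + r / 2 * (\<Sum>k<n. b k)" for n
  proof -
    have "norm (\<Sum>k<n. u k) \<le> (\<Sum>k<n. norm (u k))"
      by (rule norm_sum)
    also have "\<dots> \<le> (\<Sum>k<n. (if k < N then b k * \<bar>z k\<bar> else 0) + r / 2 * b k)"
    proof (rule sum_mono)
      fix k
      have 1: "b k * z k \<le> b k * \<bar>z k\<bar>"
        using b by (simp add: mult_left_mono)
      have 2: "b k * z k \<le> b k * (r / 2)" if "k \<ge> N"
        using N[OF that] b[of k] by (intro mult_left_mono) auto
      show "norm (u k) \<le> (if k < N then b k * \<bar>z k\<bar> else 0) + r / 2 * b k"
        using u[of k] 1 2 b[of k] \<open>r > 0\<close> by (auto simp: mult.commute intro: order_trans)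
    qed
    also have "\<dots> = (\<Sum>k\<in>{..<n} \<inter> {..<N}. b k * \<bar>z k\<bar>) + r / 2 * (\<Sum>k<n. b k)"
      by (simp add: sum.distrib sum_distrib_left sum.inter_restrict)
    also have "(\<Sum>k\<in>{..<n} \<inter> {..<N}. b k * \<bar>z k\<bar>) \<le> K"
      unfolding K_def using b by (intro sum_mono2) auto
    finally show ?thesis
      by simp
  qed
  \<comment> \<open>Beyond this threshold \<open>K\<close> lies strictly below \<open>r / 2\<close>
    times the total weight; the \<open>+ 1\<close> secures strictness even when
    \<open>K = 0\<close>.\<close>
  have "eventually (\<lambda>n. (\<Sum>k<n. b k) \<ge> (2 * K + 1) / r) sequentially"
    using div by (auto simp: filterlim_at_top)
  then obtain n0 where n0: "\<And>n. n \<ge> n0 \<Longrightarrow> (\<Sum>k<n. b k) \<ge> (2 * K + 1) / r"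
    by (auto simp: eventually_sequentially)
  show "\<exists>n0. \<forall>n\<ge>n0. norm ((\<Sum>k<n. u k) /\<^sub>R (\<Sum>k<n. b k) - 0) < r"
  proof (intro exI allI impI)
    fix n assume "n \<ge> n0"
    define A where "A = (\<Sum>k<n. b k)"
    have A: "A \<ge> (2 * K + 1) / r"
      using n0[OF \<open>n \<ge> n0\<close>] A_def by simp
    then have rA: "r * A \<ge> 2 * K + 1"
      using \<open>r > 0\<close> by (simp add: divide_simps mult.commute)
    have "(2 * K + 1) / r > 0"
      using K \<open>r > 0\<close> by simp
    with A have "A > 0"
      by linarith
    have "norm (\<Sum>k<n. u k) < r * A"
      using bound[of n] rA by (simp add: A_def[symmetric])
    then show "norm ((\<Sum>k<n. u k) /\<^sub>R (\<Sum>k<n. b k) - 0) < r"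
      using \<open>A > 0\<close> by (simp add: A_def[symmetric] divide_simps mult.commute)
  qed
qed

lemma weighted_average_tendsto:
  fixes x :: "nat \<Rightarrow> 'a::real_normed_vector" and b :: "nat \<Rightarrow> real"
  assumes b: "\<And>k. 0 \<le> b k"
    and div: "filterlim (\<lambda>n. \<Sum>k<n. b k) at_top sequentially"
    and x: "x \<longlonglongrightarrow> l"
  shows "(\<lambda>n. (\<Sum>k<n. b k *\<^sub>R x k) /\<^sub>R (\<Sum>k<n. b k)) \<longlonglongrightarrow> l"
proof -
  have "(\<lambda>k. norm (x k - l)) \<longlonglongrightarrow> 0"
    using x by (simp add: LIM_zero tendsto_norm_zero)
  then have "(\<lambda>n. (\<Sum>k<n. b k *\<^sub>R (x k - l)) /\<^sub>R (\<Sum>k<n. b k)) \<longlonglongrightarrow> 0"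
    by (intro weighted_sum_vanishes[OF b div]) (simp_all add: b)
  moreover have "eventually (\<lambda>n. (\<Sum>k<n. b k) > 0) sequentially"
    using div by (auto simp: filterlim_at_top_dense)
  then have "eventually (\<lambda>n. (\<Sum>k<n. b k *\<^sub>R (x k - l)) /\<^sub>R (\<Sum>k<n. b k)
      = (\<Sum>k<n. b k *\<^sub>R x k) /\<^sub>R (\<Sum>k<n. b k) - l) sequentially"
    by eventually_elim
      (simp add: scaleR_diff_right sum_subtractf flip: scaleR_sum_left)
  ultimately have "(\<lambda>n. (\<Sum>k<n. b k *\<^sub>R x k) /\<^sub>R (\<Sum>k<n. b k) - l) \<longlonglongrightarrow> 0"
    by (rule Lim_transform_eventually)
  then show ?thesis
    by (rule LIM_zero_cancel)
qed

text \<open>Abel summation with the boundary value at \<open>n\<close>, one past the last summand.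
  It is applied to the partial sums of a series in Kronecker's lemma and to the averaged sequence
  itself in the drift estimate.\<close>

lemma summation_by_parts:
  fixes x :: "nat \<Rightarrow> 'a::real_vector" and b :: "nat \<Rightarrow> real"
  shows "(\<Sum>k<n. b k *\<^sub>R x k) =
    (\<Sum>k<n. b k) *\<^sub>R x n - (\<Sum>k<n. (\<Sum>j<Suc k. b j) *\<^sub>R (x (Suc k) - x k))"
  by (induction n) (simp_all add: algebra_simps)

text \<open>With \<open>S\<close> the partial sums of the convergent series, \<open>u k\<close>
  weighted by \<open>b k\<close> is the total mass through \<open>k\<close> times the increment of
  \<open>S\<close>. Abel summation then leaves \<open>S n\<close> minus a weighted mean of earlier
  values of \<open>S\<close>, and both have the same limit.\<close>

lemma Kronecker_lemma:
  fixes u :: "nat \<Rightarrow> 'a::real_normed_vector" and b :: "nat \<Rightarrow> real"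
  assumes b: "\<And>k. 0 < b k"
    and div: "filterlim (\<lambda>n. \<Sum>k<n. b k) at_top sequentially"
    and conv: "convergent (\<lambda>n. \<Sum>k<n. (b k / (\<Sum>j<Suc k. b j)) *\<^sub>R u k)"
  shows "(\<lambda>n. (\<Sum>k<n. b k *\<^sub>R u k) /\<^sub>R (\<Sum>k<n. b k)) \<longlonglongrightarrow> 0"
proof -
  define S where "S n = (\<Sum>k<n. (b k / (\<Sum>j<Suc k. b j)) *\<^sub>R u k)" for n
  obtain s where s: "S \<longlonglongrightarrow> s"
    using conv by (auto simp: convergent_def S_def[abs_def])
  have pos: "(\<Sum>j<Suc k. b j) > 0" for k
    using b by (intro sum_pos) auto
  have "(\<Sum>j<Suc k. b j) *\<^sub>R (S (Suc k) - S k) = b k *\<^sub>R u k" for k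
    using pos[of k] by (simp add: S_def)
  with summation_by_parts[of b S]
  have eq: "(\<Sum>k<n. b k *\<^sub>R u k) = (\<Sum>k<n. b k) *\<^sub>R S n - (\<Sum>k<n. b k *\<^sub>R S k)" for n
    by (simp add: algebra_simps)
  have "(\<lambda>n. S n - (\<Sum>k<n. b k *\<^sub>R S k) /\<^sub>R (\<Sum>k<n. b k)) \<longlonglongrightarrow> s - s"
    by (intro tendsto_diff s weighted_average_tendsto div less_imp_le b)
  moreover have "eventually (\<lambda>n. (\<Sum>k<n. b k) > 0) sequentially"
    using div by (auto simp: filterlim_at_top_dense)
  then have "eventually (\<lambda>n. S n - (\<Sum>k<n. b k *\<^sub>R S k) /\<^sub>R (\<Sum>k<n. b k)
      = (\<Sum>k<n. b k *\<^sub>R u k) /\<^sub>R (\<Sum>k<n. b k)) sequentially"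
    by eventually_elim (simp add: eq scaleR_diff_right)
  ultimately show ?thesis
    by (auto intro: Lim_transform_eventually)
qed

text \<open>All nonempty partial sums are at least \<open>b 0\<close>, so each normalised weight is
  at most \<open>b k / b 0\<close>. This turns condition (a) into divergence of \<alpha>, the form
  in which the averaging lemmas use it.\<close>

lemma weights_diverge:
  fixes b :: "nat \<Rightarrow> real"
  assumes b: "\<And>k. 0 < b k"
    and div: "filterlim (\<lambda>n. \<Sum>k<n. b k / (\<Sum>j<Suc k. b j)) at_top sequentially"
  shows "filterlim (\<lambda>n. \<Sum>k<n. b k) at_top sequentially"
proof (rule filterlim_at_top_mono)
  show "filterlim (\<lambda>n. b 0 * (\<Sum>k<n. b k / (\<Sum>j<Suc k. b j))) at_top sequentially"
    using b div by (intro filterlim_tendsto_pos_mult_at_top[OF tendsto_const])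
  have "b 0 * (b k / (\<Sum>j<Suc k. b j)) \<le> b k" for k
  proof -
    have "b 0 \<le> (\<Sum>j<Suc k. b j)"
      using b by (intro member_le_sum[of 0 _ b]) (auto intro: less_imp_le)
    then show ?thesis
      using b[of 0] b[of k] by (simp add: divide_simps mult_left_mono)
  qed
  then show "eventually (\<lambda>n. b 0 * (\<Sum>k<n. b k / (\<Sum>j<Suc k. b j)) \<le> (\<Sum>k<n. b k)) sequentially"
    by (intro always_eventually allI) (simp add: sum_distrib_left sum_mono)
qed

text \<open>The increment bound comes with the weight of step \<open>k\<close> but is averaged with total mass up to
  step \<open>k + 2\<close>. Since the weights tend to \<open>0\<close>, consecutive total masses are asymptotically
  equal, so the shift of the index is harmless.\<close>

lemma drift_vanishes:
  fixes x :: "nat \<Rightarrow> 'a::real_normed_vector" and b :: "nat \<Rightarrow> real"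
  assumes b: "\<And>k. 0 < b k"
    and div: "filterlim (\<lambda>n. \<Sum>k<n. b k) at_top sequentially"
    and weight: "(\<lambda>k. b k / (\<Sum>j<Suc k. b j)) \<longlonglongrightarrow> 0"
    and slow: "(\<lambda>k. norm (x (Suc (Suc k)) - x (Suc k)) / (b k / (\<Sum>j<Suc k. b j))) \<longlonglongrightarrow> 0"
  shows "(\<lambda>n. (\<Sum>k<Suc n. b k *\<^sub>R x k) /\<^sub>R (\<Sum>k<Suc n. b k) - x n) \<longlonglongrightarrow> 0"
proof -
  define A where "A n = (\<Sum>k<n. b k)" for n
  have A_pos: "A (Suc k) > 0" for k
    unfolding A_def using b by (intro sum_pos) auto
  have A_Suc: "A (Suc k) = A k + b k" for k
    by (simp add: A_def)
  have div': "filterlim A at_top sequentially"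
    using div by (simp add: A_def[abs_def])
  define u where "u k = A (Suc k) *\<^sub>R (x (Suc k) - x k)" for k
  \<comment> \<open>The first factor equals \<open>A (Suc (Suc k)) / A (Suc k)\<close> and tends to
    1. It exchanges the mass normalising \<open>b k\<close> for the mass that multiplies the
    increment in \<open>u (Suc k)\<close>.\<close>
  define z where "z k = inverse (1 - b (Suc k) / A (Suc (Suc k))) *
    (norm (x (Suc (Suc k)) - x (Suc k)) / (b k / A (Suc k)))" for k
  have weight': "(\<lambda>k. b (Suc k) / A (Suc (Suc k))) \<longlonglongrightarrow> 0"
    using LIMSEQ_Suc[OF weight] by (simp only: A_def)
  have "z \<longlonglongrightarrow> inverse (1 - 0) * 0"
    unfolding z_def
    by (intro tendsto_mult tendsto_inverse tendsto_diff tendsto_const weight'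
        slow[folded A_def]) simp
  then have z: "z \<longlonglongrightarrow> 0"
    by simp
  have u_Suc: "norm (u (Suc k)) \<le> b k * z k" for k
  proof -
    have "1 - b (Suc k) / A (Suc (Suc k)) = A (Suc k) / A (Suc (Suc k))"
      using A_pos[of "Suc k"] A_Suc[of "Suc k"] by (simp add: field_simps)
    then have "b k * z k = A (Suc (Suc k)) * norm (x (Suc (Suc k)) - x (Suc k))"
      using A_pos[of k] A_pos[of "Suc k"] b[of k] by (simp add: z_def field_simps)
    then show ?thesis
      using A_pos[of "Suc k"] by (simp add: u_def)
  qed
  have "(\<lambda>n. (\<Sum>k<n. u (Suc k)) /\<^sub>R A n) \<longlonglongrightarrow> 0"
    unfolding A_def
    by (rule weighted_sum_vanishes[OF less_imp_le[OF b] div u_Suc z])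
  then have "(\<lambda>n. norm ((\<Sum>k<n. u (Suc k)) /\<^sub>R A n)) \<longlonglongrightarrow> 0"
    by (rule tendsto_norm_zero)
  moreover have "(\<lambda>n. norm (u 0) / A n) \<longlonglongrightarrow> 0"
    by (intro tendsto_divide_0[OF tendsto_const] filterlim_at_top_imp_at_infinity div')
  ultimately have lim: "(\<lambda>n. norm (u 0) / A n + norm ((\<Sum>k<n. u (Suc k)) /\<^sub>R A n)) \<longlonglongrightarrow> 0"
    using tendsto_add by fastforce
  have parts: "(\<Sum>k<Suc n. b k *\<^sub>R x k) = A (Suc n) *\<^sub>R x n - (\<Sum>k<n. u k)" for n
    using summation_by_parts[of b x n] by (simp add: A_def u_def algebra_simps)
  have "(\<lambda>n. (\<Sum>k<Suc (Suc n). b k *\<^sub>R x k) /\<^sub>R A (Suc (Suc n)) - x (Suc n)) \<longlonglongrightarrow> 0"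
  proof (rule Lim_null_comparison[OF _ lim])
    show "eventually (\<lambda>n. norm ((\<Sum>k<Suc (Suc n). b k *\<^sub>R x k) /\<^sub>R A (Suc (Suc n)) - x (Suc n))
        \<le> norm (u 0) / A n + norm ((\<Sum>k<n. u (Suc k)) /\<^sub>R A n)) sequentially"
      using eventually_gt_at_top[of 0]
    proof eventually_elim
      case (elim n)
      then have An: "A n > 0"
        using A_pos[of "n - 1"] by simp
      have "(\<Sum>k<Suc (Suc n). b k *\<^sub>R x k) /\<^sub>R A (Suc (Suc n)) - x (Suc n)
          = - ((\<Sum>k<Suc n. u k) /\<^sub>R A (Suc (Suc n)))"
        using A_pos[of "Suc n"] by (simp only: parts) (simp add: scaleR_diff_right scaleR_add_right)
      \<comment> \<open>The term \<open>u 0\<close> is split off because \<open>slow\<close>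
        controls increments from index 1 on. Lowering the denominator to \<open>A n\<close> then
        matches it to the weights of the remaining \<open>n\<close> terms.\<close>
      also have "norm \<dots> = norm (u 0 + (\<Sum>k<n. u (Suc k))) / A (Suc (Suc n))"
        using A_pos[of "Suc n"] by (subst sum.lessThan_Suc_shift) (simp add: divide_inverse_commute)
      also have "\<dots> \<le> (norm (u 0) + norm (\<Sum>k<n. u (Suc k))) / A n"
        using An A_Suc[of n] A_Suc[of "Suc n"] b[of n] b[of "Suc n"]
        by (intro frac_le norm_triangle_ineq) auto
      also have "\<dots> = norm (u 0) / A n + norm ((\<Sum>k<n. u (Suc k)) /\<^sub>R A n)"
        using An by (simp add: divide_simps)
      finally show ?case .
    qed
  qed
  then show ?thesis
    unfolding A_def by (rule LIMSEQ_imp_Suc)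
qed

text \<open>Since \<open>A (Suc k) \<le> A n\<close> for \<open>k < n\<close>, the quotient is at
  most the weighted mean of \<open>b k / A (Suc k)\<close>, which vanishes with its entries. This is
  how the weaker condition in (2) controls the noise.\<close>

lemma squared_weights_vanish:
  fixes b :: "nat \<Rightarrow> real"
  assumes b: "\<And>k. 0 < b k"
    and div: "filterlim (\<lambda>n. \<Sum>k<n. b k) at_top sequentially"
    and weight: "(\<lambda>k. b k / (\<Sum>j<Suc k. b j)) \<longlonglongrightarrow> 0"
  shows "(\<lambda>n. (\<Sum>k<n. (b k)\<^sup>2) / (\<Sum>k<n. b k)\<^sup>2) \<longlonglongrightarrow> 0"
proof (rule Lim_null_comparison)
  define A where "A n = (\<Sum>k<n. b k)" for n
  show "(\<lambda>n. (\<Sum>k<n. b k *\<^sub>R (b k / A (Suc k))) /\<^sub>R A n) \<longlonglongrightarrow> 0"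
    unfolding A_def using b by (intro weighted_average_tendsto div weight less_imp_le)
  show "eventually (\<lambda>n. norm ((\<Sum>k<n. (b k)\<^sup>2) / (\<Sum>k<n. b k)\<^sup>2)
      \<le> (\<Sum>k<n. b k *\<^sub>R (b k / A (Suc k))) /\<^sub>R A n) sequentially"
    using eventually_gt_at_top[of 0]
  proof eventually_elim
    case (elim n)
    then have An: "A n > 0"
      unfolding A_def using b by (intro sum_pos) auto
    have "(\<Sum>k<n. (b k)\<^sup>2) \<le> (\<Sum>k<n. A n * (b k * (b k / A (Suc k))))"
    proof (rule sum_mono)
      fix k assume "k \<in> {..<n}"
      then have "A (Suc k) \<le> A n"
        unfolding A_def using b by (intro sum_mono2) (auto intro: less_imp_le)
      moreover have "A (Suc k) > 0"
        unfolding A_def using b by (intro sum_pos) auto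
      ultimately have "1 \<le> A n / A (Suc k)"
        by simp
      from mult_left_mono[OF this, of "(b k)\<^sup>2"]
      show "(b k)\<^sup>2 \<le> A n * (b k * (b k / A (Suc k)))"
        by (simp add: power2_eq_square ac_simps)
    qed
    then have "(\<Sum>k<n. (b k)\<^sup>2) / (A n)\<^sup>2 \<le> (A n * (\<Sum>k<n. b k * (b k / A (Suc k)))) / (A n)\<^sup>2"
      by (intro divide_right_mono) (simp_all add: sum_distrib_left)
    also have "\<dots> = (\<Sum>k<n. b k * (b k / A (Suc k))) / A n"
      using An by (simp add: power2_eq_square)
    finally show ?case
      by (simp add: A_def[of n] divide_inverse_commute sum_nonneg)
  qed
qed

section \<open>Orthogonal noise\<close>

lemma integrable_inner_square_integrable:
  fixes X Y :: "'a \<Rightarrow> 'e::euclidean_space"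
  assumes [measurable]: "X \<in> borel_measurable M" "Y \<in> borel_measurable M"
    and X: "integrable M (\<lambda>x. (norm (X x))\<^sup>2)" and Y: "integrable M (\<lambda>x. (norm (Y x))\<^sup>2)"
  shows "integrable M (\<lambda>x. X x \<bullet> Y x)"
proof (rule Bochner_Integration.integrable_bound)
  show "integrable M (\<lambda>x. (norm (X x))\<^sup>2 + (norm (Y x))\<^sup>2)"
    by (intro Bochner_Integration.integrable_add X Y)
  show "AE x in M. norm (X x \<bullet> Y x) \<le> norm ((norm (X x))\<^sup>2 + (norm (Y x))\<^sup>2)"
  proof (intro AE_I2)
    fix x
    have "\<bar>X x \<bullet> Y x\<bar> \<le> norm (X x) * norm (Y x)"
      by (rule Cauchy_Schwarz_ineq2)
    moreover have "2 * (norm (X x) * norm (Y x)) \<le> (norm (X x))\<^sup>2 + (norm (Y x))\<^sup>2"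
      using sum_squares_bound[of "norm (X x)" "norm (Y x)"] by (simp add: algebra_simps)
    moreover have "0 \<le> norm (X x) * norm (Y x)"
      by simp
    ultimately show "norm (X x \<bullet> Y x) \<le> norm ((norm (X x))\<^sup>2 + (norm (Y x))\<^sup>2)"
      by simp
  qed
qed simp

lemma (in filtration) measurable_F_mono:
  "X \<in> F i \<rightarrow>\<^sub>M R \<Longrightarrow> i \<le> j \<Longrightarrow> X \<in> F j \<rightarrow>\<^sub>M R"
  by (rule measurable_from_subalg[of _ "F i"]) (simp_all add: subalgebra_def sets_F_mono space_F)

text \<open>Martingale differences bounded in mean square. Zero conditional mean is phrased as
  orthogonality to every square-integrable vector known at time \<open>k\<close>, which is the form
  in which cross terms appear below.\<close>

locale square_integrable_noise = prob_space M + filtration "space M" F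
  for M :: "'s measure" and F :: "nat \<Rightarrow> 's measure" +
  fixes N :: "nat \<Rightarrow> 's \<Rightarrow> 'e::euclidean_space" and C :: real
  assumes sub_past: "\<And>k. sets (F k) \<subseteq> sets M"
    and noise_adapted: "\<And>k. N k \<in> borel_measurable (F (Suc k))"
    and noise_square_integrable: "\<And>k. integrable M (\<lambda>\<omega>. (norm (N k \<omega>))\<^sup>2)"
    and noise_second_moment: "\<And>k. expectation (\<lambda>\<omega>. (norm (N k \<omega>))\<^sup>2) \<le> C"
    and noise_orthogonal: "\<And>k Y. Y \<in> borel_measurable (F k) \<Longrightarrow>
      integrable M (\<lambda>\<omega>. (norm (Y \<omega>))\<^sup>2) \<Longrightarrow> expectation (\<lambda>\<omega>. Y \<omega> \<bullet> N k \<omega>) = 0"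
begin

lemma measurable_F_imp_M:
  "X \<in> F k \<rightarrow>\<^sub>M R \<Longrightarrow> X \<in> M \<rightarrow>\<^sub>M R"
  by (rule measurable_from_subalg[of _ "F k"]) (simp_all add: subalgebra_def sub_past space_F)

lemma noise_measurable: "N k \<in> borel_measurable M"
  by (rule measurable_F_imp_M[OF noise_adapted])

lemma C_nonneg: "0 \<le> C"
  using noise_second_moment[of 0]
  by (rule order_trans[rotated]) simp

text \<open>Pythagoras: the cross term pairs the new noise with a vector determined by the past, so
  its expectation is 0. The predicate \<open>P\<close> allows the step to be switched off by the
  past, covering plain and frozen sums at once.\<close>

lemma second_moment_step:
  fixes c :: real
  assumes Y: "Y \<in> borel_measurable (F k)" and Y2: "integrable M (\<lambda>\<omega>. (norm (Y \<omega>))\<^sup>2)"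
    and P: "Measurable.pred (F k) P"
  defines "Z \<equiv> (\<lambda>\<omega>. Y \<omega> + (if P \<omega> then c *\<^sub>R N k \<omega> else 0))"
  shows "Z \<in> borel_measurable (F (Suc k))"
    and "integrable M (\<lambda>\<omega>. (norm (Z \<omega>))\<^sup>2)"
    and "expectation (\<lambda>\<omega>. (norm (Z \<omega>))\<^sup>2) \<le> expectation (\<lambda>\<omega>. (norm (Y \<omega>))\<^sup>2) + C * c\<^sup>2"
proof -
  have [measurable]: "Y \<in> borel_measurable (F (Suc k))" "Measurable.pred (F (Suc k)) P"
      "N k \<in> borel_measurable (F (Suc k))"
    using Y P noise_adapted by (auto intro: measurable_F_mono[of _ k])
  show "Z \<in> borel_measurable (F (Suc k))"
    unfolding Z_def by measurable
  have [measurable]: "Y \<in> borel_measurable M" "Measurable.pred M P" "N k \<in> borel_measurable M"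
    using Y P noise_measurable by (auto intro: measurable_F_imp_M)
  \<comment> \<open>The factor \<open>c\<close> and the switch move to the past side, so that the
    cross term is literally an inner product with \<open>N k\<close>.\<close>
  define Y' where "Y' \<omega> = (if P \<omega> then c *\<^sub>R Y \<omega> else 0)" for \<omega>
  have Y': "Y' \<in> borel_measurable (F k)"
    unfolding Y'_def using Y P by measurable
  have [measurable]: "Y' \<in> borel_measurable M"
    using Y' by (rule measurable_F_imp_M)
  have Y'2: "integrable M (\<lambda>\<omega>. (norm (Y' \<omega>))\<^sup>2)"
    by (rule Bochner_Integration.integrable_bound[where f="\<lambda>\<omega>. c\<^sup>2 * (norm (Y \<omega>))\<^sup>2"])
      (use Y2 in \<open>auto simp: Y'_def power_mult_distrib\<close>)
  have inner: "integrable M (\<lambda>\<omega>. Y' \<omega> \<bullet> N k \<omega>)"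
    by (intro integrable_inner_square_integrable Y'2 noise_square_integrable) measurable
  define Q where "Q \<omega> = (if P \<omega> then c\<^sup>2 * (norm (N k \<omega>))\<^sup>2 else 0)" for \<omega>
  have [measurable]: "Q \<in> borel_measurable M"
    unfolding Q_def by measurable
  have Q: "integrable M Q"
    by (rule Bochner_Integration.integrable_bound[where f="\<lambda>\<omega>. c\<^sup>2 * (norm (N k \<omega>))\<^sup>2"])
      (use noise_square_integrable in \<open>auto simp: Q_def\<close>)
  have Z2: "(norm (Z \<omega>))\<^sup>2 = (norm (Y \<omega>))\<^sup>2 + 2 * (Y' \<omega> \<bullet> N k \<omega>) + Q \<omega>" for \<omega>
    unfolding Z_def Y'_def Q_def power2_norm_eq_inner
    by (simp add: inner_add_left inner_add_right inner_commute power2_eq_square)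
  show "integrable M (\<lambda>\<omega>. (norm (Z \<omega>))\<^sup>2)"
    unfolding Z2 by (intro Bochner_Integration.integrable_add Y2 Q integrable_mult_right inner)
  have "expectation Q \<le> expectation (\<lambda>\<omega>. c\<^sup>2 * (norm (N k \<omega>))\<^sup>2)"
    by (rule integral_mono) (use Q noise_square_integrable in \<open>auto simp: Q_def\<close>)
  also have "\<dots> \<le> C * c\<^sup>2"
    using mult_left_mono[OF noise_second_moment[of k], of "c\<^sup>2"] by (simp add: mult.commute)
  finally show "expectation (\<lambda>\<omega>. (norm (Z \<omega>))\<^sup>2) \<le> expectation (\<lambda>\<omega>. (norm (Y \<omega>))\<^sup>2) + C * c\<^sup>2"
    unfolding Z2 using noise_orthogonal[OF Y' Y'2] Y2 Q inner by simp
qed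

text \<open>The case of \<open>P\<close> constantly true. One induction proves all three claims,
  since each step uses measurability and integrability of the previous sum.\<close>

lemma weighted_noise_second_moment:
  shows weighted_noise_adapted: "(\<lambda>\<omega>. \<Sum>k<n. \<gamma> k *\<^sub>R N k \<omega>) \<in> borel_measurable (F n)"
    and "integrable M (\<lambda>\<omega>. (norm (\<Sum>k<n. \<gamma> k *\<^sub>R N k \<omega>))\<^sup>2)"
    and "expectation (\<lambda>\<omega>. (norm (\<Sum>k<n. \<gamma> k *\<^sub>R N k \<omega>))\<^sup>2) \<le> C * (\<Sum>k<n. (\<gamma> k)\<^sup>2)"
proof (induction n)
  case (Suc n)
  { case 1 then show ?case
      using second_moment_step(1)[where P="\<lambda>_. True" and c="\<gamma> n", OF Suc(1,2)] by simp }
  { case 2 then show ?case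
      using second_moment_step(2)[where P="\<lambda>_. True" and c="\<gamma> n", OF Suc(1,2)] by simp }
  { case 3 then show ?case
      using second_moment_step(3)[where P="\<lambda>_. True" and c="\<gamma> n", OF Suc(1,2)] Suc(3)
      by (simp add: algebra_simps) }
qed simp_all

section \<open>Maximal inequality and almost sure convergence of noise series\<close>

text \<open>The partial sums from index \<open>m\<close> on, frozen once their norm reaches \<open>\<delta>\<close>. Freezing is
  decided by the past, so it preserves orthogonality, and Chebyshev's inequality for the frozen
  sums is Kolmogorov's inequality for the original ones.\<close>

primrec stopped :: "(nat \<Rightarrow> real) \<Rightarrow> real \<Rightarrow> nat \<Rightarrow> nat \<Rightarrow> 's \<Rightarrow> 'e" where
  "stopped \<gamma> \<delta> m 0 \<omega> = 0"
| "stopped \<gamma> \<delta> m (Suc j) \<omega> = stopped \<gamma> \<delta> m j \<omega> +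
    (if norm (stopped \<gamma> \<delta> m j \<omega>) < \<delta> then \<gamma> (m + j) *\<^sub>R N (m + j) \<omega> else 0)"

lemma stopped_second_moment:
  shows stopped_adapted: "stopped \<gamma> \<delta> m j \<in> borel_measurable (F (m + j))"
    and "integrable M (\<lambda>\<omega>. (norm (stopped \<gamma> \<delta> m j \<omega>))\<^sup>2)"
    and "expectation (\<lambda>\<omega>. (norm (stopped \<gamma> \<delta> m j \<omega>))\<^sup>2) \<le> C * (\<Sum>i<j. (\<gamma> (m + i))\<^sup>2)"
proof (induction j)
  case (Suc j)
  have P: "Measurable.pred (F (m + j)) (\<lambda>\<omega>. norm (stopped \<gamma> \<delta> m j \<omega>) < \<delta>)"
    using Suc(1) by measurable
  note step = second_moment_step[where c="\<gamma> (m + j)", OF Suc(1,2) P]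
  { case 1 then show ?case
      using step(1) by (simp only: stopped.simps(2)[abs_def] add_Suc_right) }
  { case 2 then show ?case
      using step(2) by simp }
  { case 3 then show ?case
      using step(3) Suc(3) by (simp add: algebra_simps) }
qed (simp_all add: stopped.simps(1)[abs_def])

lemma stopped_exceeds:
  assumes "i \<le> j" and "\<delta> \<le> norm (\<Sum>l<i. \<gamma> (m + l) *\<^sub>R N (m + l) \<omega>)"
  shows "\<delta> \<le> norm (stopped \<gamma> \<delta> m j \<omega>)"
proof -
  have "(\<forall>i\<le>j. norm (\<Sum>l<i. \<gamma> (m + l) *\<^sub>R N (m + l) \<omega>) < \<delta>) \<and>
      stopped \<gamma> \<delta> m j \<omega> = (\<Sum>l<j. \<gamma> (m + l) *\<^sub>R N (m + l) \<omega>) \<or>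
      \<delta> \<le> norm (stopped \<gamma> \<delta> m j \<omega>)" for j
    by (induction j) (auto simp: le_Suc_eq not_less)
  from this[of j] show ?thesis
    using assms by force
qed

lemma maximal_inequality:
  assumes \<delta>: "\<delta> > 0" and \<gamma>: "summable (\<lambda>k. (\<gamma> k)\<^sup>2)"
  shows "prob {\<omega> \<in> space M. \<exists>i. \<delta> \<le> norm (\<Sum>l<i. \<gamma> (m + l) *\<^sub>R N (m + l) \<omega>)}
    \<le> C * (\<Sum>i. (\<gamma> (m + i))\<^sup>2) / \<delta>\<^sup>2"
proof -
  have [measurable]: "N k \<in> borel_measurable M" for k
    by (rule noise_measurable)
  have [measurable]: "stopped \<gamma> \<delta> m j \<in> borel_measurable M" for j
    by (rule measurable_F_imp_M[OF stopped_adapted])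
  define E where "E j = {\<omega> \<in> space M. \<exists>i\<le>j. \<delta> \<le> norm (\<Sum>l<i. \<gamma> (m + l) *\<^sub>R N (m + l) \<omega>)}" for j
  have E_bound: "prob (E j) \<le> C * (\<Sum>i. (\<gamma> (m + i))\<^sup>2) / \<delta>\<^sup>2" for j
  proof -
    have "prob (E j) \<le> prob {\<omega> \<in> space M. \<delta>\<^sup>2 \<le> (norm (stopped \<gamma> \<delta> m j \<omega>))\<^sup>2}"
    proof (rule finite_measure_mono)
      show "E j \<subseteq> {\<omega> \<in> space M. \<delta>\<^sup>2 \<le> (norm (stopped \<gamma> \<delta> m j \<omega>))\<^sup>2}"
        using \<delta> by (auto simp: E_def intro!: power_mono dest: stopped_exceeds)
    qed measurable
    also have "\<dots> \<le> expectation (\<lambda>\<omega>. (norm (stopped \<gamma> \<delta> m j \<omega>))\<^sup>2) / \<delta>\<^sup>2"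
      using \<delta> by (intro integral_Markov_inequality_measure[where A="{}"] stopped_second_moment) auto
    also have "\<dots> \<le> C * (\<Sum>i<j. (\<gamma> (m + i))\<^sup>2) / \<delta>\<^sup>2"
      by (intro divide_right_mono stopped_second_moment) simp
    also have "\<dots> \<le> C * (\<Sum>i. (\<gamma> (m + i))\<^sup>2) / \<delta>\<^sup>2"
      using \<gamma> C_nonneg
      by (intro divide_right_mono mult_left_mono sum_le_suminf)
        (auto simp: add.commute[of m] summable_ignore_initial_segment[where f="\<lambda>k. (\<gamma> k)\<^sup>2"])
    finally show ?thesis .
  qed
  have "(\<lambda>j. prob (E j)) \<longlonglongrightarrow> prob (\<Union>j. E j)"
  proof (rule finite_Lim_measure_incseq)
    show "range E \<subseteq> events"
      unfolding E_def by auto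
    show "incseq E"
      by (auto simp: incseq_def E_def intro: order_trans)
  qed
  then have "prob (\<Union>j. E j) \<le> C * (\<Sum>i. (\<gamma> (m + i))\<^sup>2) / \<delta>\<^sup>2"
    by (rule LIMSEQ_le_const2) (use E_bound in blast)
  also have "(\<Union>j. E j) = {\<omega> \<in> space M. \<exists>i. \<delta> \<le> norm (\<Sum>l<i. \<gamma> (m + l) *\<^sub>R N (m + l) \<omega>)}"
    by (auto simp: E_def)
  finally show ?thesis .
qed

text \<open>The exceptional event lies in every \<open>B m\<close>, and the maximal inequality
  bounds these by a multiple of a tail of the convergent series of squares, which tends to
  0.\<close>

lemma AE_tail_small:
  assumes \<delta>: "\<delta> > 0" and \<gamma>: "summable (\<lambda>k. (\<gamma> k)\<^sup>2)"
  shows "AE \<omega> in M. \<exists>m. \<forall>i. norm (\<Sum>l<i. \<gamma> (m + l) *\<^sub>R N (m + l) \<omega>) < \<delta>"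
proof -
  have [measurable]: "N k \<in> borel_measurable M" for k
    by (rule noise_measurable)
  define B where "B m = {\<omega> \<in> space M. \<exists>i. \<delta> \<le> norm (\<Sum>l<i. \<gamma> (m + l) *\<^sub>R N (m + l) \<omega>)}" for m
  have B: "B m \<in> events" for m
    unfolding B_def by measurable
  then have I: "(\<Inter>m. B m) \<in> events"
    by auto
  have "prob (\<Inter>m. B m) \<le> 0"
  proof (rule LIMSEQ_le_const)
    have "(\<lambda>m. \<Sum>i. (\<gamma> (m + i))\<^sup>2) \<longlonglongrightarrow> 0"
      using suminf_exist_split2[OF \<gamma>] by (simp add: add.commute)
    then have "(\<lambda>m. C * (\<Sum>i. (\<gamma> (m + i))\<^sup>2) / \<delta>\<^sup>2) \<longlonglongrightarrow> C * 0 / \<delta>\<^sup>2"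
      using \<delta> by (intro tendsto_divide tendsto_mult tendsto_const) auto
    then show "(\<lambda>m. C * (\<Sum>i. (\<gamma> (m + i))\<^sup>2) / \<delta>\<^sup>2) \<longlonglongrightarrow> 0"
      by simp
    have "prob (\<Inter>m. B m) \<le> C * (\<Sum>i. (\<gamma> (m + i))\<^sup>2) / \<delta>\<^sup>2" for m
    proof -
      have "prob (\<Inter>m. B m) \<le> prob (B m)"
        using B by (intro finite_measure_mono) auto
      also have "\<dots> \<le> C * (\<Sum>i. (\<gamma> (m + i))\<^sup>2) / \<delta>\<^sup>2"
        unfolding B_def by (rule maximal_inequality[OF \<delta> \<gamma>])
      finally show ?thesis .
    qed
    then show "\<exists>m0. \<forall>m\<ge>m0. prob (\<Inter>m. B m) \<le> C * (\<Sum>i. (\<gamma> (m + i))\<^sup>2) / \<delta>\<^sup>2"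
      by blast
  qed
  then have "prob (\<Inter>m. B m) = 0"
    by (simp add: measure_le_0_iff)
  then have "AE \<omega> in M. \<omega> \<notin> (\<Inter>m. B m)"
    using I by (subst (asm) prob_eq_0) auto
  then show ?thesis
    by (rule AE_mp) (auto simp: B_def not_le)
qed

lemma AE_convergent:
  assumes \<gamma>: "summable (\<lambda>k. (\<gamma> k)\<^sup>2)"
  shows "AE \<omega> in M. convergent (\<lambda>n. \<Sum>k<n. \<gamma> k *\<^sub>R N k \<omega>)"
proof -
  \<comment> \<open>Restricting \<delta> to the countable family of
    \<open>inverse (real (Suc p))\<close> yields a single null set; off it the partial sums are
    Cauchy.\<close>
  have "AE \<omega> in M. \<forall>p. \<exists>m. \<forall>i. norm (\<Sum>l<i. \<gamma> (m + l) *\<^sub>R N (m + l) \<omega>) < inverse (real (Suc p))"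
    unfolding AE_all_countable by (intro allI AE_tail_small \<gamma>) simp
  then show ?thesis
  proof eventually_elim
    case (elim \<omega>)
    define S where "S n = (\<Sum>k<n. \<gamma> k *\<^sub>R N k \<omega>)" for n
    have shift: "(\<Sum>l<i. \<gamma> (m + l) *\<^sub>R N (m + l) \<omega>) = S (m + i) - S m" for m i
      by (induction i) (simp_all add: S_def algebra_simps)
    have "Cauchy S"
    proof (rule metric_CauchyI)
      fix e :: real assume "e > 0"
      then obtain p where p: "inverse (real (Suc p)) < e / 2"
        using reals_Archimedean[of "e / 2"] by auto
      obtain m where m: "\<And>i. norm (S (m + i) - S m) < inverse (real (Suc p))"
        using elim shift by metis
      have close: "dist (S n) (S m) < e / 2" if "n \<ge> m" for n
        using m[of "n - m"] p that by (simp add: dist_norm)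
      show "\<exists>m. \<forall>n\<ge>m. \<forall>k\<ge>m. dist (S n) (S k) < e"
        using close dist_triangle_half_l by blast
    qed
    then show ?case
      by (simp add: Cauchy_convergent_iff S_def[abs_def])
  qed
qed

end

section \<open>Gradients of the mean loss\<close>

text \<open>Mean value inequality on the segment from \<open>w\<close> to \<open>w + h\<close>,
  along which the gradient moves by at most \<open>L * norm h\<close>. Only the quadratic order
  matters later, so \<open>L\<close> stands where \<open>L / 2\<close> would be sharp.\<close>

lemma linearization_error:
  fixes g :: "'e::euclidean_space \<Rightarrow> real"
  assumes G: "\<And>w. GDERIV g w :> G w" and L: "L-lipschitz_on UNIV G"
  shows "\<bar>g (w + h) - g w - G w \<bullet> h\<bar> \<le> L * (norm h)\<^sup>2"
proof -
  have "norm (g (w + h) - g w - (w + h - w) \<bullet> G w) \<le> norm (w + h - w) * (L * norm h)"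
  proof (rule differentiable_bound_linearization[where S="closed_segment w (w + h)"
        and f'="\<lambda>x v. v \<bullet> G x"])
    show "w + t *\<^sub>R (w + h - w) \<in> closed_segment w (w + h)" if "t \<in> {0..1}" for t
      using that by (auto simp: closed_segment_def algebra_simps intro!: exI[of _ t])
    show "(g has_derivative (\<lambda>h. h \<bullet> G x)) (at x within closed_segment w (w + h))" for x
      using G[of x] by (simp add: gderiv_def has_derivative_at_withinI)
    show "onorm ((\<lambda>v. v \<bullet> G x) - (\<lambda>v. v \<bullet> G w)) \<le> L * norm h"
      if x: "x \<in> closed_segment w (w + h)" for x
    proof (rule onorm_le)
      fix v
      have "norm (x - w) \<le> norm h"
        using segment_bound1[OF x] by simp
      then have "norm (G x - G w) \<le> L * norm h"
        using lipschitz_onD[OF L, of x w] lipschitz_on_nonneg[OF L]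
        by (auto simp: dist_norm intro: order_trans mult_left_mono)
      moreover have "norm (((\<lambda>v. v \<bullet> G x) - (\<lambda>v. v \<bullet> G w)) v) \<le> norm (G x - G w) * norm v"
        using Cauchy_Schwarz_ineq2[of "G x - G w" v]
        by (simp add: inner_diff_left inner_commute[of v])
      ultimately show "norm (((\<lambda>v. v \<bullet> G x) - (\<lambda>v. v \<bullet> G w)) v) \<le> L * norm h * norm v"
        by (meson mult_right_mono norm_ge_zero order_trans)
    qed
    show "w \<in> closed_segment w (w + h)"
      by simp
  qed
  then show ?thesis
    by (simp add: inner_commute power2_eq_square mult.left_commute)
qed

text \<open>A quadratic remainder is \<open>o(norm h)\<close>. Such a bound survives taking
  expectations, so it can carry differentiability from the losses to their mean.\<close>

lemma GDERIV_quadratic_bound: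
  fixes g :: "'e::euclidean_space \<Rightarrow> real"
  assumes "\<And>h. \<bar>g (w + h) - g w - v \<bullet> h\<bar> \<le> L * (norm h)\<^sup>2"
  shows "GDERIV g w :> v"
  unfolding gderiv_def has_derivative_at
proof (intro conjI bounded_linear_inner_left)
  have "((\<lambda>h. L * norm h) \<longlongrightarrow> L * norm (0 :: 'e)) (at (0 :: 'e))"
    by (intro tendsto_mult_left tendsto_norm[OF tendsto_ident_at])
  then have "((\<lambda>h::'e. L * norm h) \<longlongrightarrow> 0) (at 0)"
    by simp
  then show "(\<lambda>h. norm (g (w + h) - g w - h \<bullet> v) / norm h) \<midarrow>0\<rightarrow> 0"
  proof (rule Lim_null_comparison[rotated])
    show "eventually (\<lambda>h. norm (norm (g (w + h) - g w - h \<bullet> v) / norm h) \<le> L * norm h) (at 0)"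
      unfolding eventually_at_filter
      by (intro always_eventually allI impI)
        (use assms in \<open>simp add: inner_commute[of _ v] divide_simps power2_eq_square mult.assoc\<close>)
  qed
qed

text \<open>Replacing the parameter by simple functions \<open>s i\<close> converging to it makes
  the map piecewise a function of \<open>x\<close> alone, hence measurable; continuity in the
  parameter passes this to the limit.\<close>

lemma borel_measurable_Caratheodory:
  fixes g :: "'a::{metric_space, second_countable_topology} \<Rightarrow> 'x \<Rightarrow> 'b::metric_space"
  assumes meas: "\<And>w. g w \<in> borel_measurable D"
    and cont: "\<And>x. x \<in> space D \<Longrightarrow> continuous_on UNIV (\<lambda>w. g w x)"
  shows "(\<lambda>(w, x). g w x) \<in> borel_measurable (borel \<Otimes>\<^sub>M D)"
proof -
  have "(\<lambda>w::'a. w) \<in> borel_measurable borel"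
    by simp
  from borel_measurable_implies_sequence_metric[OF this, of undefined]
  obtain s :: "nat \<Rightarrow> 'a \<Rightarrow> 'a" where s: "\<And>i. simple_function borel (s i)"
    and lim: "\<And>w. (\<lambda>i. s i w) \<longlonglongrightarrow> w"
    unfolding space_borel by blast
  show ?thesis
  proof (rule borel_measurable_LIMSEQ_metric)
    show "(\<lambda>p. g (s i (fst p)) (snd p)) \<in> borel_measurable (borel \<Otimes>\<^sub>M D)" for i
    proof (rule measurable_compose_countable'[where I="range (s i)"])
      have "s i \<in> borel \<rightarrow>\<^sub>M count_space (range (s i))"
        by (rule measurable_count_space_extend[OF subset_UNIV _ measurable_simple_function[OF s]]) auto
      then show "(\<lambda>p. s i (fst p)) \<in> borel \<Otimes>\<^sub>M D \<rightarrow>\<^sub>M count_space (range (s i))"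
        by measurable
      show "countable (range (s i))"
        using s[of i] by (auto simp: simple_function_def space_borel intro: countable_finite)
      show "(\<lambda>p. g w (snd p)) \<in> borel_measurable (borel \<Otimes>\<^sub>M D)" for w
        using meas by measurable
    qed
    show "(\<lambda>i. g (s i (fst p)) (snd p)) \<longlonglongrightarrow> (case p of (w, x) \<Rightarrow> g w x)"
      if "p \<in> space (borel \<Otimes>\<^sub>M D)" for p
      using that continuous_on_tendsto_compose[OF cont lim]
      by (auto simp: space_pair_measure)
  qed
qed

text \<open>\<open>G\<close> is a version of the sample gradient: Lipschitz for every sample and
  jointly measurable, but a true gradient only for almost every sample. It replaces
  \<open>grad (f x)\<close>, whose values at bad samples are uncontrolled.\<close>

locale stochastic_gradient = prob_space D
  for D :: "'w measure" +
  fixes f :: "'w \<Rightarrow> 'e::euclidean_space \<Rightarrow> real" and L :: real and G :: "'e \<Rightarrow> 'w \<Rightarrow> 'e"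
  assumes integrable_loss: "\<And>w. integrable D (\<lambda>x. f x w)"
    and gradient_measurable: "(\<lambda>(w, x). G w x) \<in> borel_measurable (borel \<Otimes>\<^sub>M D)"
    and gradient_lipschitz: "\<And>x. L-lipschitz_on UNIV (\<lambda>w. G w x)"
    and AE_gradient: "AE x in D. \<forall>w. GDERIV (f x) w :> G w x"
begin

lemma gradient_measurable' [measurable]: "G w \<in> borel_measurable D"
  using measurable_compose[OF measurable_Pair1' gradient_measurable, of w] by simp

lemma L_nonneg: "0 \<le> L"
  using gradient_lipschitz[of undefined] by (rule lipschitz_on_nonneg)

lemma AE_linearization_error:
  "AE x in D. \<forall>w h. \<bar>f x (w + h) - f x w - G w x \<bullet> h\<bar> \<le> L * (norm h)\<^sup>2"
  using AE_gradient
proof eventually_elim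
  case (elim x)
  then show ?case
    using linearization_error[of "f x" "\<lambda>w. G w x" L] gradient_lipschitz by blast
qed

text \<open>Each coordinate differs from the unit-step difference \<open>f x (w + b) - f x w\<close>
  by at most \<open>L\<close>, so integrable losses dominate the l1 norm of the gradient.\<close>

lemma integrable_gradient: "integrable D (G w)"
proof (rule Bochner_Integration.integrable_bound)
  show "integrable D (\<lambda>x. \<Sum>b\<in>Basis. \<bar>f x (w + b)\<bar> + \<bar>f x w\<bar> + L)"
    using integrable_loss by auto
  show "AE x in D. norm (G w x) \<le> norm (\<Sum>b\<in>Basis. \<bar>f x (w + b)\<bar> + \<bar>f x w\<bar> + L)"
    using AE_linearization_error
  proof eventually_elim
    case (elim x)
    have "norm (G w x) \<le> (\<Sum>b\<in>Basis. \<bar>G w x \<bullet> b\<bar>)"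
      by (rule norm_le_l1)
    also have "\<dots> \<le> (\<Sum>b\<in>Basis. \<bar>f x (w + b)\<bar> + \<bar>f x w\<bar> + L)"
    proof (rule sum_mono)
      fix b :: 'e assume "b \<in> Basis"
      then have "\<bar>f x (w + b) - f x w - G w x \<bullet> b\<bar> \<le> L"
        using elim[rule_format, of w b] by simp
      then show "\<bar>G w x \<bullet> b\<bar> \<le> \<bar>f x (w + b)\<bar> + \<bar>f x w\<bar> + L"
        by linarith
    qed
    finally show ?case
      by simp
  qed
qed simp

definition mean_gradient :: "'e \<Rightarrow> 'e" where
  "mean_gradient w = expectation (G w)"

lemma mean_gradient_lipschitz: "L-lipschitz_on UNIV mean_gradient"
proof (rule lipschitz_onI)
  fix v w
  have "norm (expectation (\<lambda>x. G v x - G w x)) \<le> expectation (\<lambda>x. L * dist v w)"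
    using lipschitz_onD[OF gradient_lipschitz, of v w] integrable_gradient
    by (intro order_trans[OF integral_norm_bound] integral_mono) (auto simp: dist_norm)
  then show "dist (mean_gradient v) (mean_gradient w) \<le> L * dist v w"
    by (simp add: mean_gradient_def dist_norm integrable_gradient prob_space)
qed (rule L_nonneg)

text \<open>Differentiation under the expectation: the quadratic linearization bound is uniform over
  almost all samples and is simply integrated.\<close>

lemma GDERIV_mean_loss: "GDERIV (mean_loss D f) w :> mean_gradient w"
proof (rule GDERIV_quadratic_bound)
  fix h
  have "mean_loss D f (w + h) - mean_loss D f w - mean_gradient w \<bullet> h
      = expectation (\<lambda>x. f x (w + h) - f x w - G w x \<bullet> h)"
    by (simp add: mean_loss_def mean_gradient_def integrable_loss integrable_gradient)
  also have "norm \<dots> \<le> expectation (\<lambda>x. L * (norm h)\<^sup>2)"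
    using AE_linearization_error integrable_loss integrable_gradient
    by (intro order_trans[OF integral_norm_bound] integral_mono_AE) auto
  finally show "\<bar>mean_loss D f (w + h) - mean_loss D f w - mean_gradient w \<bullet> h\<bar> \<le> L * (norm h)\<^sup>2"
    by (simp add: prob_space)
qed

lemma grad_mean_loss: "grad (mean_loss D f) = mean_gradient"
  by (intro ext grad_eqI GDERIV_mean_loss)

lemma mean_gradient_measurable [measurable]: "mean_gradient \<in> borel_measurable borel"
  using mean_gradient_lipschitz
  by (intro borel_measurable_continuous_onI lipschitz_on_continuous_on)

text \<open>Variance is second moment minus squared mean, so centring keeps the bound
  \<open>C\<close>.\<close>

lemma gradient_variance_le:
  assumes C: "(\<integral>\<^sup>+ x. ennreal ((norm (G w x))\<^sup>2) \<partial>D) \<le> ennreal C" "0 \<le> C"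
  shows "(\<integral>\<^sup>+ x. ennreal ((norm (G w x - mean_gradient w))\<^sup>2) \<partial>D) \<le> ennreal C"
proof -
  have sq: "integrable D (\<lambda>x. (norm (G w x))\<^sup>2)"
    using C(1) by (intro integrableI_bounded) (auto simp: le_less_trans[OF _ ennreal_less_top])
  have eq: "(norm (G w x - mean_gradient w))\<^sup>2 =
      (norm (G w x))\<^sup>2 - 2 * (G w x \<bullet> mean_gradient w) + (norm (mean_gradient w))\<^sup>2" for x
    unfolding power2_norm_eq_inner
    by (simp add: inner_diff_left inner_diff_right inner_commute)
  have int: "integrable D (\<lambda>x. (norm (G w x - mean_gradient w))\<^sup>2)"
    unfolding eq using sq integrable_gradient by simp
  have "expectation (\<lambda>x. (norm (G w x - mean_gradient w))\<^sup>2) =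
      expectation (\<lambda>x. (norm (G w x))\<^sup>2) - (norm (mean_gradient w))\<^sup>2"
    unfolding eq using sq integrable_gradient
    by (simp add: prob_space power2_norm_eq_inner flip: mean_gradient_def)
  also have "\<dots> \<le> expectation (\<lambda>x. (norm (G w x))\<^sup>2)"
    by simp
  also have "\<dots> \<le> C"
    using C nn_integral_eq_integral[OF sq] by simp
  finally show ?thesis
    using nn_integral_eq_integral[OF int] by (simp add: ennreal_leI)
qed

end

text \<open>The gradient is set to 0 on a null set of bad samples. Difference quotients of the
  measurable losses give measurability in the sample, and Lipschitz continuity in \<open>w\<close>
  upgrades it to joint measurability.\<close>

lemma (in prob_space) stochastic_gradient_exists:
  fixes f :: "'a \<Rightarrow> 'e::euclidean_space \<Rightarrow> real"
  assumes integrable_loss: "\<And>w. integrable M (\<lambda>x. f x w)"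
    and smooth: "AE x in M. (\<forall>w. f x differentiable (at w)) \<and> L-lipschitz_on UNIV (grad (f x))"
  obtains G where "stochastic_gradient M f L G"
proof -
  from AE_E[OF smooth] obtain Z where
    Z: "{x \<in> space M. \<not> ((\<forall>w. f x differentiable (at w)) \<and> L-lipschitz_on UNIV (grad (f x)))} \<subseteq> Z"
      "emeasure M Z = 0" "Z \<in> sets M"
    by blast
  then have good: "AE x in M. x \<notin> Z"
    by (intro AE_not_in) auto
  have deriv: "GDERIV (f x) w :> grad (f x) w" and lip: "L-lipschitz_on UNIV (grad (f x))"
    if "x \<in> space M" "x \<notin> Z" for x w
    using Z(1) that by (auto intro!: GDERIV_grad)
  \<comment> \<open>A good sample exists because the space has mass 1. Its Lipschitz bound forces
    \<open>0 \<le> L\<close>, which the zero gradient on \<open>Z\<close> must satisfy too.\<close>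
  have "\<exists>x. x \<in> space M \<and> x \<notin> Z"
    using Z(2) emeasure_space_1 by (metis subsetI emeasure_mono Z(3) not_one_le_zero)
  then have L: "0 \<le> L"
    using lip lipschitz_on_nonneg by blast
  define G where "G w x = (if x \<in> space M \<and> x \<notin> Z then grad (f x) w else 0)" for w x
  have G_lip: "L-lipschitz_on UNIV (\<lambda>w. G w x)" for x
    using lip[of x] L by (auto simp: G_def lipschitz_on_def)
  have "G w \<in> borel_measurable M" for w
  proof (subst borel_measurable_euclidean_space, intro ballI)
    fix b :: 'e assume b: "b \<in> Basis"
    define q where "q n x = (if x \<notin> Z then (f x (w + inverse (real (Suc n)) *\<^sub>R b) - f x w) * real (Suc n) else 0)"
      for n x
    show "(\<lambda>x. G w x \<bullet> b) \<in> borel_measurable M"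
    proof (rule borel_measurable_LIMSEQ_real)
      have [measurable]: "(\<lambda>x. f x w) \<in> borel_measurable M" for w
        using integrable_loss by (rule borel_measurable_integrable)
      show "q n \<in> borel_measurable M" for n
        unfolding q_def using Z(3) by measurable
      fix x assume x: "x \<in> space M"
      show "(\<lambda>n. q n x) \<longlonglongrightarrow> G w x \<bullet> b"
      proof (cases "x \<in> Z")
        case False
        \<comment> \<open>The linearization error for the step \<open>b / (n + 1)\<close> is at most
          \<open>L / (n + 1)^2\<close>, as \<open>b\<close> has norm 1; dividing by the step length
          leaves \<open>L / (n + 1)\<close>.\<close>
        have "norm (q n x - G w x \<bullet> b) \<le> L * inverse (real (Suc n))" for n
        proof -
          define h where "h = inverse (real (Suc n)) *\<^sub>R b"
          have "\<bar>f x (w + h) - f x w - grad (f x) w \<bullet> h\<bar> \<le> L * (norm h)\<^sup>2"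
            using linearization_error[OF deriv lip] x False by blast
          then have "\<bar>f x (w + h) - f x w - grad (f x) w \<bullet> h\<bar> * real (Suc n)
              \<le> L * (norm h)\<^sup>2 * real (Suc n)"
            by (rule mult_right_mono) simp
          also have "(norm h)\<^sup>2 * real (Suc n) = inverse (real (Suc n))"
            using b by (simp add: h_def power2_eq_square field_simps del: of_nat_Suc)
          then have "L * (norm h)\<^sup>2 * real (Suc n) = L * inverse (real (Suc n))"
            by (simp only: mult.assoc)
          also have "\<bar>f x (w + h) - f x w - grad (f x) w \<bullet> h\<bar> * real (Suc n) =
              \<bar>(f x (w + h) - f x w - grad (f x) w \<bullet> h) * real (Suc n)\<bar>"
            by (simp only: abs_mult abs_of_nat)
          also have "(f x (w + h) - f x w - grad (f x) w \<bullet> h) * real (Suc n) = q n x - G w x \<bullet> b"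
            using x False by (simp add: q_def G_def h_def field_simps del: of_nat_Suc)
          finally show ?thesis
            by simp
        qed
        then have "eventually (\<lambda>n. norm (q n x - G w x \<bullet> b) \<le> L * inverse (real (Suc n))) sequentially"
          by (intro always_eventually allI)
        moreover have "(\<lambda>n. L * inverse (real (Suc n))) \<longlonglongrightarrow> 0"
          by (intro tendsto_mult_right_zero LIMSEQ_inverse_real_of_nat)
        ultimately have "(\<lambda>n. q n x - G w x \<bullet> b) \<longlonglongrightarrow> 0"
          by (rule Lim_null_comparison)
        then show ?thesis
          by (rule LIM_zero_cancel)
      qed (simp add: q_def G_def)
    qed
  qed
  then have "(\<lambda>(w, x). G w x) \<in> borel_measurable (borel \<Otimes>\<^sub>M M)"
    using G_lip by (intro borel_measurable_Caratheodory lipschitz_on_continuous_on)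
  moreover have "AE x in M. \<forall>w. GDERIV (f x) w :> G w x"
    using good AE_space by eventually_elim (auto simp: G_def deriv)
  ultimately have "stochastic_gradient M f L G"
    using integrable_loss G_lip by unfold_locales
  then show thesis
    by (rule that)
qed

section \<open>The averaged gradient of the algorithm\<close>

locale smooth_rmda =
  rmda M D F f \<psi> W0 \<eta> c \<xi> V Wmin W + D: stochastic_gradient D f L G
  for M :: "'s measure" and D :: "'w measure" and F :: "nat \<Rightarrow> 's measure"
    and f :: "'w \<Rightarrow> 'e::euclidean_space \<Rightarrow> real" and \<psi> :: "'e \<Rightarrow> ereal" and W0 :: 'e
    and \<eta> c :: "nat \<Rightarrow> real" and \<xi> :: "nat \<Rightarrow> 's \<Rightarrow> 'w"
    and V Wmin W :: "nat \<Rightarrow> 's \<Rightarrow> 'e" and L :: real and G :: "'e \<Rightarrow> 'w \<Rightarrow> 'e" +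
  fixes C :: real
  assumes C_nonneg: "0 \<le> C"
    and second_moment: "\<And>k. AE \<omega> in M. (\<integral>\<^sup>+ x. ennreal ((norm (G (W k \<omega>) x))\<^sup>2) \<partial>D) \<le> ennreal C"
begin

text \<open>Indices are shifted so that \<open>rate k\<close> belongs to step \<open>Suc k\<close>;
  then \<alpha> at \<open>n\<close> is the sum over \<open>k < n\<close>.\<close>

definition rate :: "nat \<Rightarrow> real" where
  "rate k = rmda_beta (Suc k) * \<eta> (Suc k)"

definition noise :: "nat \<Rightarrow> 's \<Rightarrow> 'e" where
  "noise k \<omega> = G (W k \<omega>) (\<xi> (Suc k) \<omega>) - D.mean_gradient (W k \<omega>)"

definition noise_average :: "nat \<Rightarrow> 's \<Rightarrow> 'e" where
  "noise_average n \<omega> = (\<Sum>k<n. rate k *\<^sub>R noise k \<omega>) /\<^sub>R (\<Sum>k<n. rate k)"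

text \<open>The index is that of the iterate compared with: \<open>drift n\<close> is part of the
  error at step \<open>Suc n\<close>, hence the \<open>Suc n\<close> summands.\<close>

definition drift :: "nat \<Rightarrow> 's \<Rightarrow> 'e" where
  "drift n \<omega> = (\<Sum>k<Suc n. rate k *\<^sub>R D.mean_gradient (W k \<omega>)) /\<^sub>R (\<Sum>k<Suc n. rate k)
    - D.mean_gradient (W n \<omega>)"

lemma rate_pos: "0 < rate k"
  using learning_rate_pos by (simp add: rate_def rmda_beta_def)

lemma rate_sum_pos: "0 < (\<Sum>k<Suc n. rate k)"
  using rate_pos by (intro sum_pos) auto

lemma alpha_eq: "rmda_alpha \<eta> n = (\<Sum>k<n. rate k)"
  by (induction n) (simp_all add: rate_def)

lemma weight_Suc: "rmda_weight \<eta> (Suc k) = rate k / (\<Sum>j<Suc k. rate j)"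
  by (simp only: rmda_weight_def alpha_eq rate_def)

lemma F_to_M: "X \<in> F k \<rightarrow>\<^sub>M R \<Longrightarrow> X \<in> M \<rightarrow>\<^sub>M R"
  by (rule measurable_from_subalg[of _ "F k"]) (simp_all add: subalgebra_def past_sub space_F)

lemma W_measurable: "W k \<in> borel_measurable (F k)"
proof (induction k)
  case 0
  show ?case
    by (subst measurable_cong[where g="\<lambda>_. W0"]) (simp_all add: space_F W_0)
next
  case (Suc k)
  have "(\<lambda>\<omega>. (1 - c (Suc k)) *\<^sub>R W k \<omega> + c (Suc k) *\<^sub>R Wmin (Suc k) \<omega>)
      \<in> borel_measurable (F (Suc k))"
    using measurable_F_mono[OF Suc, of "Suc k"] Wmin_measurable[of k] by measurable
  then show ?case
    by (subst measurable_cong) (simp_all add: space_F W_Suc)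
qed

lemma sample_measurable_M: "\<xi> (Suc t) \<in> M \<rightarrow>\<^sub>M D"
  by (rule F_to_M[OF sample_measurable])

lemma id_measurable_F: "(\<lambda>\<omega>. \<omega>) \<in> M \<rightarrow>\<^sub>M F t"
  by (rule F_to_M[of _ t]) simp

section \<open>Joint law of the past and a fresh sample\<close>

text \<open>The library notion of independent random variables requires a common codomain type, so it
  does not apply to the pair of the identity and the sample.\<close>

lemma past_sample_joint_distr:
  "distr M (F t) (\<lambda>\<omega>. \<omega>) \<Otimes>\<^sub>M D = distr M (F t \<Otimes>\<^sub>M D) (\<lambda>\<omega>. (\<omega>, \<xi> (Suc t) \<omega>))"
proof (rule pair_measure_eqI)
  show "sigma_finite_measure (distr M (F t) (\<lambda>\<omega>. \<omega>))"
    by (intro prob_space_imp_sigma_finite prob_space_distr id_measurable_F)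
  show "sigma_finite_measure D"
    by (rule D.sigma_finite_measure_axioms)
  have joint: "(\<lambda>\<omega>. (\<omega>, \<xi> (Suc t) \<omega>)) \<in> M \<rightarrow>\<^sub>M F t \<Otimes>\<^sub>M D"
    by (intro measurable_Pair id_measurable_F sample_measurable_M)
  fix A B
  assume A: "A \<in> sets (distr M (F t) (\<lambda>\<omega>. \<omega>))" and B: "B \<in> sets D"
  let ?B = "\<xi> (Suc t) -` B \<inter> space M"
  have "A \<subseteq> space M"
    using A sets.sets_into_space[of A "F t"] by (simp add: space_F)
  \<comment> \<open>A product measure is determined on rectangles, where the joint law is the
    probability of a past event together with a sample event and factorises by independence.\<close>
  then have "emeasure (distr M (F t \<Otimes>\<^sub>M D) (\<lambda>\<omega>. (\<omega>, \<xi> (Suc t) \<omega>))) (A \<times> B) = emeasure M (A \<inter> ?B)"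
    using A B by (subst emeasure_distr[OF joint]) (auto intro!: arg_cong[where f="emeasure M"])
  also have "\<dots> = emeasure M A * emeasure M ?B"
    using A B indep_setD[OF sample_indep_past[of t], of A ?B]
    by (auto simp: emeasure_eq_measure simp flip: ennreal_mult')
  also have "emeasure M ?B = emeasure D B"
    using emeasure_distr[OF sample_measurable_M B, of t] by (simp only: sample_distr)
  also have "emeasure M A = emeasure (distr M (F t) (\<lambda>\<omega>. \<omega>)) A"
    using A \<open>A \<subseteq> space M\<close> by (subst emeasure_distr[OF id_measurable_F]) (auto simp: Int_absorb2)
  finally show "emeasure (distr M (F t) (\<lambda>\<omega>. \<omega>)) A * emeasure D B =
      emeasure (distr M (F t \<Otimes>\<^sub>M D) (\<lambda>\<omega>. (\<omega>, \<xi> (Suc t) \<omega>))) (A \<times> B)"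
    by simp
qed simp

text \<open>Tonelli for the joint law: the sample is integrated out with the past frozen, in place
  of conditioning on \<open>F t\<close>.\<close>

lemma nn_integral_fresh_sample:
  assumes h: "h \<in> borel_measurable (F t \<Otimes>\<^sub>M D)"
  shows "(\<integral>\<^sup>+ \<omega>. h (\<omega>, \<xi> (Suc t) \<omega>) \<partial>M) = (\<integral>\<^sup>+ \<omega>. \<integral>\<^sup>+ x. h (\<omega>, x) \<partial>D \<partial>M)"
proof -
  note [measurable] = h id_measurable_F sample_measurable_M
  have h': "h \<in> borel_measurable (distr M (F t) (\<lambda>\<omega>. \<omega>) \<Otimes>\<^sub>M D)"
    using h by simp
  have "(\<integral>\<^sup>+ \<omega>. h (\<omega>, \<xi> (Suc t) \<omega>) \<partial>M) =
      (\<integral>\<^sup>+ p. h p \<partial>(distr M (F t) (\<lambda>\<omega>. \<omega>) \<Otimes>\<^sub>M D))"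
    unfolding past_sample_joint_distr by (subst nn_integral_distr) simp_all
  also have "\<dots> = (\<integral>\<^sup>+ \<omega>. \<integral>\<^sup>+ x. h (\<omega>, x) \<partial>D \<partial>(distr M (F t) (\<lambda>\<omega>. \<omega>)))"
    using D.nn_integral_fst[OF h'] by simp
  also have "\<dots> = (\<integral>\<^sup>+ \<omega>. \<integral>\<^sup>+ x. h (\<omega>, x) \<partial>D \<partial>M)"
    by (subst nn_integral_distr) (simp_all add: D.borel_measurable_nn_integral_fst)
  finally show ?thesis .
qed

lemma integral_fresh_sample:
  fixes h :: "'s \<times> 'w \<Rightarrow> real"
  assumes h: "h \<in> borel_measurable (F t \<Otimes>\<^sub>M D)"
    and int: "integrable M (\<lambda>\<omega>. h (\<omega>, \<xi> (Suc t) \<omega>))"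
  shows "(\<integral> \<omega>. h (\<omega>, \<xi> (Suc t) \<omega>) \<partial>M) = (\<integral> \<omega>. \<integral> x. h (\<omega>, x) \<partial>D \<partial>M)"
proof -
  note [measurable] = h id_measurable_F sample_measurable_M
  interpret past: prob_space "distr M (F t) (\<lambda>\<omega>. \<omega>)"
    by (rule prob_space_distr) (rule id_measurable_F)
  interpret pair_sigma_finite "distr M (F t) (\<lambda>\<omega>. \<omega>)" D ..
  have "integrable (distr M (F t) (\<lambda>\<omega>. \<omega>) \<Otimes>\<^sub>M D) h"
    unfolding past_sample_joint_distr using int by (subst integrable_distr_eq) simp_all
  from integral_fst'[OF this]
  have "(\<integral> \<omega>. \<integral> x. h (\<omega>, x) \<partial>D \<partial>(distr M (F t) (\<lambda>\<omega>. \<omega>))) = (\<integral> \<omega>. h (\<omega>, \<xi> (Suc t) \<omega>) \<partial>M)"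
    unfolding past_sample_joint_distr by (subst (asm) (2) integral_distr) simp_all
  then show ?thesis
    by (subst (asm) integral_distr) simp_all
qed

text \<open>Joint measurability of \<open>G\<close> is what allows it to be evaluated at the random
  point \<open>W k\<close>.\<close>

lemma frozen_noise_measurable:
  "(\<lambda>(\<omega>, x). G (W k \<omega>) x - D.mean_gradient (W k \<omega>)) \<in> borel_measurable (F k \<Otimes>\<^sub>M D)"
proof -
  note [measurable] = W_measurable[of k]
  have "(\<lambda>p. (W k (fst p), snd p)) \<in> F k \<Otimes>\<^sub>M D \<rightarrow>\<^sub>M borel \<Otimes>\<^sub>M D"
    by measurable
  from measurable_compose[OF this D.gradient_measurable]
  have [measurable]: "(\<lambda>p. G (W k (fst p)) (snd p)) \<in> borel_measurable (F k \<Otimes>\<^sub>M D)"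
    by simp
  show ?thesis
    unfolding case_prod_beta by measurable
qed

lemma noise_measurable_F: "noise k \<in> borel_measurable (F (Suc k))"
proof -
  have id: "(\<lambda>\<omega>. \<omega>) \<in> F (Suc k) \<rightarrow>\<^sub>M F k"
    by (rule measurable_F_mono[of _ k]) simp_all
  have "(\<lambda>\<omega>. (\<omega>, \<xi> (Suc k) \<omega>)) \<in> F (Suc k) \<rightarrow>\<^sub>M F k \<Otimes>\<^sub>M D"
    by (intro measurable_Pair id sample_measurable)
  from measurable_compose[OF this frozen_noise_measurable] show ?thesis
    by (simp add: noise_def[abs_def])
qed

lemma noise_measurable_M: "noise k \<in> borel_measurable M"
  by (rule F_to_M[OF noise_measurable_F])

text \<open>With the past frozen, the inner integral is the variance of the gradient at the fixed
  point \<open>W k \<omega>\<close>, for almost every run at most \<open>C\<close>.\<close>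

lemma noise_second_moment: "(\<integral>\<^sup>+ \<omega>. ennreal ((norm (noise k \<omega>))\<^sup>2) \<partial>M) \<le> ennreal C"
proof -
  define h where "h p = ennreal ((norm ((\<lambda>(\<omega>, x). G (W k \<omega>) x - D.mean_gradient (W k \<omega>)) p))\<^sup>2)" for p
  have "h \<in> borel_measurable (F k \<Otimes>\<^sub>M D)"
    unfolding h_def using frozen_noise_measurable[of k] by measurable
  from nn_integral_fresh_sample[OF this]
  have "(\<integral>\<^sup>+ \<omega>. ennreal ((norm (noise k \<omega>))\<^sup>2) \<partial>M) =
      (\<integral>\<^sup>+ \<omega>. \<integral>\<^sup>+ x. ennreal ((norm (G (W k \<omega>) x - D.mean_gradient (W k \<omega>)))\<^sup>2) \<partial>D \<partial>M)"
    by (simp add: h_def noise_def)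
  also have "\<dots> \<le> (\<integral>\<^sup>+ \<omega>. ennreal C \<partial>M)"
    using second_moment[of k]
    by (intro nn_integral_mono_AE) (auto elim!: eventually_mono intro: D.gradient_variance_le C_nonneg)
  finally show ?thesis
    by (simp add: emeasure_space_1)
qed

lemma noise_square_integrable: "integrable M (\<lambda>\<omega>. (norm (noise k \<omega>))\<^sup>2)"
  using noise_measurable_M[of k] le_less_trans[OF noise_second_moment[of k] ennreal_less_top]
  by (intro integrableI_bounded) simp_all

text \<open>With the past frozen, \<open>Y\<close> and \<open>W k\<close> are constants and the
  fresh gradient averages to the mean gradient, so the inner integral is 0.\<close>

lemma noise_orthogonal:
  assumes Y: "Y \<in> borel_measurable (F k)" and Y2: "integrable M (\<lambda>\<omega>. (norm (Y \<omega>))\<^sup>2)"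
  shows "expectation (\<lambda>\<omega>. Y \<omega> \<bullet> noise k \<omega>) = 0"
proof -
  define h where
    "h p = Y (fst p) \<bullet> (\<lambda>(\<omega>, x). G (W k \<omega>) x - D.mean_gradient (W k \<omega>)) p" for p
  have h: "h \<in> borel_measurable (F k \<Otimes>\<^sub>M D)"
    unfolding h_def using frozen_noise_measurable[of k] Y by measurable
  have "integrable M (\<lambda>\<omega>. Y \<omega> \<bullet> noise k \<omega>)"
    by (intro integrable_inner_square_integrable F_to_M[OF Y] noise_measurable_M Y2
        noise_square_integrable)
  then have "integrable M (\<lambda>\<omega>. h (\<omega>, \<xi> (Suc k) \<omega>))"
    by (simp add: h_def noise_def)
  from integral_fresh_sample[OF h this]
  have "expectation (\<lambda>\<omega>. Y \<omega> \<bullet> noise k \<omega>) =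
      (\<integral> \<omega>. \<integral> x. Y \<omega> \<bullet> (G (W k \<omega>) x - D.mean_gradient (W k \<omega>)) \<partial>D \<partial>M)"
    by (simp add: h_def noise_def)
  moreover have "(\<integral> x. Y \<omega> \<bullet> (G (W k \<omega>) x - D.mean_gradient (W k \<omega>)) \<partial>D) = 0" for \<omega>
    using D.integrable_gradient[of "W k \<omega>"]
    by (simp add: inner_diff_right D.prob_space D.mean_gradient_def)
  ultimately show ?thesis
    by simp
qed

sublocale noise: square_integrable_noise M F noise C
proof
  show "sets (F k) \<subseteq> sets M" for k
    by (rule past_sub)
  show "expectation (\<lambda>\<omega>. (norm (noise k \<omega>))\<^sup>2) \<le> C" for k
    using noise_second_moment[of k] C_nonneg
    by (subst (asm) nn_integral_eq_integral[OF noise_square_integrable]) simp_all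
qed (fact noise_measurable_F noise_square_integrable noise_orthogonal)+

section \<open>Error as noise plus drift, and their almost sure limits\<close>

lemma AE_error_decomposition:
  "AE \<omega> in M. \<forall>n. rmda_error \<eta> (mean_loss D f) V W (Suc n) \<omega> = noise_average (Suc n) \<omega> + drift n \<omega>"
proof -
  \<comment> \<open>Each sample has law \<open>D\<close>, so the null set of bad samples pulls back
    to a null set of runs; over all steps these form one null set.\<close>
  have "AE x in distr M D (\<xi> (Suc k)). \<forall>w. GDERIV (f x) w :> G w x" for k
    unfolding sample_distr by (rule D.AE_gradient)
  then have "AE \<omega> in M. \<forall>w. GDERIV (f (\<xi> (Suc k) \<omega>)) w :> G w (\<xi> (Suc k) \<omega>)" for k
    by (rule AE_distrD[OF sample_measurable_M])
  then have "AE \<omega> in M. \<forall>k w. GDERIV (f (\<xi> (Suc k) \<omega>)) w :> G w (\<xi> (Suc k) \<omega>)"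
    unfolding AE_all_countable by blast
  with AE_space show ?thesis
  proof eventually_elim
    case (elim \<omega>)
    then have "grad (f (\<xi> (Suc k) \<omega>)) w = G w (\<xi> (Suc k) \<omega>)" for k w
      by (intro grad_eqI) blast
    then have V: "V n \<omega> = (\<Sum>k<n. rate k *\<^sub>R noise k \<omega>) + (\<Sum>k<n. rate k *\<^sub>R D.mean_gradient (W k \<omega>))" for n
      using elim(1) by (induction n) (simp_all add: V_0 V_Suc noise_def rate_def algebra_simps)
    show ?case
      unfolding rmda_error_def D.grad_mean_loss alpha_eq V noise_average_def drift_def
      by (auto simp only: scaleR_add_right diff_Suc_1 add_diff_eq)
  qed
qed

lemma AE_drift_vanishes:
  assumes div: "filterlim (\<lambda>n. \<Sum>k<n. rate k) at_top sequentially"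
    and weight: "rmda_weight \<eta> \<longlonglongrightarrow> 0"
    and slow: "AE \<omega> in M. (\<lambda>t. norm (W (t + 1) \<omega> - W t \<omega>) / rmda_weight \<eta> t) \<longlonglongrightarrow> 0"
  shows "AE \<omega> in M. (\<lambda>n. drift n \<omega>) \<longlonglongrightarrow> 0"
  using slow
proof eventually_elim
  case (elim \<omega>)
  let ?x = "\<lambda>k. D.mean_gradient (W k \<omega>)"
  \<comment> \<open>Index 0 is dropped because the weight there is \<open>0 / 0 = 0\<close>; at
    positive indices it is positive, so the Lipschitz bound can be divided by it.\<close>
  have "(\<lambda>k. norm (W (Suc (Suc k)) \<omega> - W (Suc k) \<omega>) / rmda_weight \<eta> (Suc k)) \<longlonglongrightarrow> 0"
    using LIMSEQ_Suc[OF elim] by simp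
  from tendsto_mult_right_zero[OF this, of L]
  have lim: "(\<lambda>k. L * (norm (W (Suc (Suc k)) \<omega> - W (Suc k) \<omega>) / rmda_weight \<eta> (Suc k))) \<longlonglongrightarrow> 0" .
  have "(\<lambda>k. norm (?x (Suc (Suc k)) - ?x (Suc k)) / rmda_weight \<eta> (Suc k)) \<longlonglongrightarrow> 0"
  proof (rule Lim_null_comparison[OF always_eventually lim], rule allI)
    fix k
    have "rmda_weight \<eta> (Suc k) > 0"
      unfolding weight_Suc using rate_pos rate_sum_pos by (rule divide_pos_pos)
    then show "norm (norm (?x (Suc (Suc k)) - ?x (Suc k)) / rmda_weight \<eta> (Suc k))
        \<le> L * (norm (W (Suc (Suc k)) \<omega> - W (Suc k) \<omega>) / rmda_weight \<eta> (Suc k))"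
      using lipschitz_onD[OF D.mean_gradient_lipschitz, of "W (Suc (Suc k)) \<omega>" "W (Suc k) \<omega>"]
      by (simp add: dist_norm divide_right_mono)
  qed
  then show ?case
    unfolding drift_def using LIMSEQ_Suc[OF weight]
    by (intro drift_vanishes rate_pos div) (simp_all only: weight_Suc)
qed

lemma AE_noise_average_vanishes:
  assumes div: "filterlim (\<lambda>n. \<Sum>k<n. rate k) at_top sequentially"
    and weight: "summable (\<lambda>t. (rmda_weight \<eta> t)\<^sup>2)"
  shows "AE \<omega> in M. (\<lambda>n. noise_average n \<omega>) \<longlonglongrightarrow> 0"
proof -
  have "summable (\<lambda>k. (rmda_weight \<eta> (Suc k))\<^sup>2)"
    using weight by (subst summable_Suc_iff)
  then have "AE \<omega> in M. convergent (\<lambda>n. \<Sum>k<n. (rate k / (\<Sum>j<Suc k. rate j)) *\<^sub>R noise k \<omega>)"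
    unfolding weight_Suc by (rule noise.AE_convergent)
  then show ?thesis
    unfolding noise_average_def by eventually_elim (intro Kronecker_lemma rate_pos div)
qed

section \<open>Second moments of noise and drift\<close>

lemma drift_measurable [measurable]: "drift n \<in> borel_measurable M"
proof -
  have [measurable]: "W k \<in> borel_measurable M" for k
    by (rule F_to_M[OF W_measurable])
  show ?thesis
    unfolding drift_def by measurable
qed

lemma noise_average_measurable [measurable]: "noise_average n \<in> borel_measurable M"
  unfolding noise_average_def using noise_measurable_M by measurable

text \<open>The factor 2 anticipates the bound of a squared sum by twice the sum of squares. At
  \<open>n = 0\<close> both sides are 0.\<close>

lemma noise_average_second_moment:
  "(\<integral>\<^sup>+ \<omega>. ennreal (2 * (norm (noise_average n \<omega>))\<^sup>2) \<partial>M)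
    \<le> ennreal (2 * C * ((\<Sum>k<n. (rate k)\<^sup>2) / (\<Sum>k<n. rate k)\<^sup>2))"
proof -
  have eq: "2 * (norm (noise_average n \<omega>))\<^sup>2 =
      2 / (\<Sum>k<n. rate k)\<^sup>2 * (norm (\<Sum>k<n. rate k *\<^sub>R noise k \<omega>))\<^sup>2" for \<omega>
    by (simp add: noise_average_def power_mult_distrib power_inverse divide_inverse)
  have "(\<integral>\<^sup>+ \<omega>. ennreal (2 * (norm (noise_average n \<omega>))\<^sup>2) \<partial>M) =
      ennreal (2 / (\<Sum>k<n. rate k)\<^sup>2 * expectation (\<lambda>\<omega>. (norm (\<Sum>k<n. rate k *\<^sub>R noise k \<omega>))\<^sup>2))"
    unfolding eq using noise.weighted_noise_second_moment(2)[of rate n]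
    by (subst nn_integral_eq_integral) auto
  also have "\<dots> \<le> ennreal (2 / (\<Sum>k<n. rate k)\<^sup>2 * (C * (\<Sum>k<n. (rate k)\<^sup>2)))"
    by (intro ennreal_leI mult_left_mono noise.weighted_noise_second_moment) simp
  also have "2 / (\<Sum>k<n. rate k)\<^sup>2 * (C * (\<Sum>k<n. (rate k)\<^sup>2)) =
      2 * C * ((\<Sum>k<n. (rate k)\<^sup>2) / (\<Sum>k<n. rate k)\<^sup>2)"
    by simp
  finally show ?thesis .
qed

text \<open>A Lipschitz map is bounded on \<open>K\<close>, say by \<open>H\<close>, and so are
  weighted means of its values there; the drift is a difference of two such vectors.\<close>

lemma AE_drift_bounded:
  assumes K: "bounded K" "AE \<omega> in M. \<forall>t. W t \<omega> \<in> K"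
  obtains B where "AE \<omega> in M. \<forall>n. norm (drift n \<omega>) \<le> B"
proof -
  have "bounded (D.mean_gradient ` K)"
    using K(1) lipschitz_on_subset[OF D.mean_gradient_lipschitz]
    by (intro bounded_uniformly_continuous_image lipschitz_on_uniformly_continuous) auto
  then obtain H where H: "\<And>w. w \<in> K \<Longrightarrow> norm (D.mean_gradient w) \<le> H"
    by (auto simp: bounded_iff)
  have "AE \<omega> in M. \<forall>n. norm (drift n \<omega>) \<le> H + H"
    using K(2)
  proof (eventually_elim, intro allI)
    fix \<omega> n assume W: "\<forall>t. W t \<omega> \<in> K"
    have "norm (\<Sum>k<Suc n. rate k *\<^sub>R D.mean_gradient (W k \<omega>)) \<le> (\<Sum>k<Suc n. rate k * H)"
      using rate_pos H W by (intro sum_norm_le) (simp add: less_imp_le mult_left_mono)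
    also have "\<dots> = (\<Sum>k<Suc n. rate k) * H"
      by (rule sum_distrib_right[symmetric])
    finally have "norm ((\<Sum>k<Suc n. rate k *\<^sub>R D.mean_gradient (W k \<omega>)) /\<^sub>R (\<Sum>k<Suc n. rate k)) \<le> H"
      using rate_sum_pos[of n] by (simp add: divide_simps mult.commute del: sum.lessThan_Suc)
    then show "norm (drift n \<omega>) \<le> H + H"
      unfolding drift_def using H W norm_triangle_le_diff add_mono by meson
  qed
  then show thesis
    by (rule that)
qed

lemma drift_second_moment_vanishes:
  assumes lim: "AE \<omega> in M. (\<lambda>n. drift n \<omega>) \<longlonglongrightarrow> 0"
    and K: "bounded K" "AE \<omega> in M. \<forall>t. W t \<omega> \<in> K"
  shows "(\<lambda>n. \<integral>\<^sup>+ \<omega>. ennreal (2 * (norm (drift n \<omega>))\<^sup>2) \<partial>M) \<longlonglongrightarrow> 0"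
proof -
  obtain B where B: "AE \<omega> in M. \<forall>n. norm (drift n \<omega>) \<le> B"
    by (rule AE_drift_bounded[OF K])
  \<comment> \<open>Almost sure convergence becomes convergence of integrals through the constant
    bound \<open>2 * B\<^sup>2\<close>, integrable on a probability space.\<close>
  have "(\<lambda>n. \<integral>\<^sup>+ \<omega>. ennreal (2 * (norm (drift n \<omega>))\<^sup>2) \<partial>M) \<longlonglongrightarrow> (\<integral>\<^sup>+ \<omega>. 0 \<partial>M)"
  proof (rule nn_integral_dominated_convergence[where w="\<lambda>_. ennreal (2 * B\<^sup>2)"])
    show "AE \<omega> in M. ennreal (2 * (norm (drift n \<omega>))\<^sup>2) \<le> ennreal (2 * B\<^sup>2)" for n
      using B by eventually_elim (intro ennreal_leI mult_left_mono power_mono, auto)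
    show "AE \<omega> in M. (\<lambda>n. ennreal (2 * (norm (drift n \<omega>))\<^sup>2)) \<longlonglongrightarrow> 0"
      using lim
    proof eventually_elim
      case (elim \<omega>)
      then have "(\<lambda>n. 2 * (norm (drift n \<omega>))\<^sup>2) \<longlonglongrightarrow> 2 * (norm (0 :: 'e))\<^sup>2"
        by (intro tendsto_intros)
      then show ?case
        using tendsto_ennrealI by fastforce
    qed
  qed (simp_all add: emeasure_space_1)
  then show ?thesis
    by simp
qed

section \<open>Both modes of convergence of the error\<close>

lemma AE_error_vanishes:
  assumes div: "filterlim (\<lambda>n. \<Sum>k<n. rate k) at_top sequentially"
    and slow: "AE \<omega> in M. (\<lambda>t. norm (W (t + 1) \<omega> - W t \<omega>) / rmda_weight \<eta> t) \<longlonglongrightarrow> 0"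
    and weight: "rmda_weight \<eta> \<longlonglongrightarrow> 0" "summable (\<lambda>t. (rmda_weight \<eta> t)\<^sup>2)"
  shows "AE \<omega> in M. (\<lambda>t. rmda_error \<eta> (mean_loss D f) V W t \<omega>) \<longlonglongrightarrow> 0"
  using AE_error_decomposition AE_noise_average_vanishes[OF div weight(2)]
    AE_drift_vanishes[OF div weight(1) slow]
proof eventually_elim
  case (elim \<omega>)
  from tendsto_add[OF LIMSEQ_Suc[OF elim(2)] elim(3)]
  have "(\<lambda>n. rmda_error \<eta> (mean_loss D f) V W (Suc n) \<omega>) \<longlonglongrightarrow> 0"
    using elim(1) by simp
  then show ?case
    by (rule LIMSEQ_imp_Suc)
qed

lemma error_second_moment_vanishes:
  assumes div: "filterlim (\<lambda>n. \<Sum>k<n. rate k) at_top sequentially"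
    and slow: "AE \<omega> in M. (\<lambda>t. norm (W (t + 1) \<omega> - W t \<omega>) / rmda_weight \<eta> t) \<longlonglongrightarrow> 0"
    and weight: "rmda_weight \<eta> \<longlonglongrightarrow> 0"
    and K: "bounded K" "AE \<omega> in M. \<forall>t. W t \<omega> \<in> K"
  shows "(\<lambda>t. \<integral>\<^sup>+ \<omega>. ennreal ((norm (rmda_error \<eta> (mean_loss D f) V W t \<omega>))\<^sup>2) \<partial>M) \<longlonglongrightarrow> 0"
    (is "?E \<longlonglongrightarrow> 0")
proof -
  define r where "r n = (\<Sum>k<n. (rate k)\<^sup>2) / (\<Sum>k<n. rate k)\<^sup>2" for n
  have "r \<longlonglongrightarrow> 0"
    unfolding r_def using LIMSEQ_Suc[OF weight]
    by (intro squared_weights_vanish rate_pos div) (simp only: weight_Suc)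
  from LIMSEQ_Suc[OF tendsto_mult_right_zero[OF this]]
  have "(\<lambda>n. ennreal (2 * C * r (Suc n))) \<longlonglongrightarrow> ennreal 0"
    by (rule tendsto_ennrealI)
  from tendsto_add[OF this drift_second_moment_vanishes[OF AE_drift_vanishes[OF div weight slow] K]]
  have upper: "(\<lambda>n. ennreal (2 * C * r (Suc n)) + (\<integral>\<^sup>+ \<omega>. ennreal (2 * (norm (drift n \<omega>))\<^sup>2) \<partial>M)) \<longlonglongrightarrow> 0"
    by simp
  have "?E (Suc n) \<le> ennreal (2 * C * r (Suc n)) + (\<integral>\<^sup>+ \<omega>. ennreal (2 * (norm (drift n \<omega>))\<^sup>2) \<partial>M)" for n
  proof -
    have split: "(norm (x + y))\<^sup>2 \<le> 2 * (norm x)\<^sup>2 + 2 * (norm y)\<^sup>2" for x y :: 'e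
    proof -
      have "(norm (x + y))\<^sup>2 \<le> (norm x + norm y)\<^sup>2"
        by (intro power_mono norm_triangle_ineq) simp
      then show ?thesis
        using sum_squares_bound[of "norm x" "norm y"] by (simp add: power2_sum)
    qed
    have "?E (Suc n) \<le> (\<integral>\<^sup>+ \<omega>. ennreal (2 * (norm (noise_average (Suc n) \<omega>))\<^sup>2) +
        ennreal (2 * (norm (drift n \<omega>))\<^sup>2) \<partial>M)"
      using AE_error_decomposition
      by (intro nn_integral_mono_AE)
        (auto elim!: eventually_mono simp: split ennreal_leI simp flip: ennreal_plus)
    also have "\<dots> = (\<integral>\<^sup>+ \<omega>. ennreal (2 * (norm (noise_average (Suc n) \<omega>))\<^sup>2) \<partial>M) +
        (\<integral>\<^sup>+ \<omega>. ennreal (2 * (norm (drift n \<omega>))\<^sup>2) \<partial>M)"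
      by (rule nn_integral_add) measurable
    finally show ?thesis
      unfolding r_def using noise_average_second_moment add_right_mono order_trans by meson
  qed
  then have "(\<lambda>n. ?E (Suc n)) \<longlonglongrightarrow> 0"
    by (intro tendsto_sandwich[OF _ _ tendsto_const upper] always_eventually) auto
  then show ?thesis
    by (rule LIMSEQ_imp_Suc)
qed

end

theorem lemma2:
  fixes M :: "'s measure" and D :: "'w measure" and F :: "nat \<Rightarrow> 's measure"
    and f :: "'w \<Rightarrow> 'e::euclidean_space \<Rightarrow> real" and \<psi> :: "'e \<Rightarrow> ereal" and W0 :: 'e
    and \<eta> c :: "nat \<Rightarrow> real" and \<xi> :: "nat \<Rightarrow> 's \<Rightarrow> 'w"
    and V Wmin W :: "nat \<Rightarrow> 's \<Rightarrow> 'e" and L C :: real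
  assumes algorithm: "rmda M D F f \<psi> W0 \<eta> c \<xi> V Wmin W"
    and smooth: "AE x in D. (\<forall>w. f x differentiable (at w)) \<and> L-lipschitz_on UNIV (grad (f x))"
    and C_nonneg: "C \<ge> 0"
    and second_moment:
      "\<forall>t\<ge>1. AE \<omega> in M. (\<integral>\<^sup>+ x. ennreal ((norm (grad (f x) (W (t - 1) \<omega>)))\<^sup>2) \<partial>D) \<le> ennreal C"
  shows "(\<forall>w. mean_loss D f differentiable (at w)) \<and>
    L-lipschitz_on UNIV (grad (mean_loss D f)) \<and>
    (filterlim (\<lambda>n. \<Sum>t=1..n. rmda_weight \<eta> t) at_top sequentially \<and>
     (AE \<omega> in M. (\<lambda>t. norm (W (t + 1) \<omega> - W t \<omega>) / rmda_weight \<eta> t) \<longlonglongrightarrow> 0) \<longrightarrow>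
       (summable (\<lambda>t. (rmda_weight \<eta> t)\<^sup>2) \<longrightarrow>
          (AE \<omega> in M. (\<lambda>t. rmda_error \<eta> (mean_loss D f) V W t \<omega>) \<longlonglongrightarrow> 0)) \<and>
       ((\<exists>K. bounded K \<and> (AE \<omega> in M. \<forall>t. W t \<omega> \<in> K)) \<and>
        (summable (\<lambda>t. (rmda_weight \<eta> t)\<^sup>2) \<or> rmda_weight \<eta> \<longlonglongrightarrow> 0) \<longrightarrow>
          (\<lambda>t. \<integral>\<^sup>+ \<omega>. ennreal ((norm (rmda_error \<eta> (mean_loss D f) V W t \<omega>))\<^sup>2) \<partial>M)
            \<longlonglongrightarrow> 0))"
proof -
  interpret rmda M D F f \<psi> W0 \<eta> c \<xi> V Wmin W
    by (rule algorithm)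
  obtain G where "stochastic_gradient D f L G"
    using D.stochastic_gradient_exists[OF loss_integrable smooth] .
  then interpret D: stochastic_gradient D f L G .
  interpret smooth_rmda M D F f \<psi> W0 \<eta> c \<xi> V Wmin W L G C
  proof
    show "AE \<omega> in M. (\<integral>\<^sup>+ x. ennreal ((norm (G (W k \<omega>) x))\<^sup>2) \<partial>D) \<le> ennreal C" for k
    proof -
      \<comment> \<open>One null set of samples serves all points \<open>w\<close>, so the moment
        bound passes from \<open>grad\<close> to \<open>G\<close> even at the random point
        \<open>W k \<omega>\<close>.\<close>
      have "AE x in D. \<forall>w. grad (f x) w = G w x"
        using D.AE_gradient by (auto elim!: eventually_mono intro: grad_eqI)
      then have "(\<integral>\<^sup>+ x. ennreal ((norm (G w x))\<^sup>2) \<partial>D) =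
          (\<integral>\<^sup>+ x. ennreal ((norm (grad (f x) w))\<^sup>2) \<partial>D)" for w
        by (intro nn_integral_cong_AE) (auto elim!: eventually_mono)
      then show ?thesis
        using second_moment[rule_format, of "Suc k"] by simp
    qed
  qed (rule C_nonneg)
  have div: "filterlim (\<lambda>n. \<Sum>k<n. rate k) at_top sequentially"
    if "filterlim (\<lambda>n. \<Sum>t=1..n. rmda_weight \<eta> t) at_top sequentially"
    using that by (intro weights_diverge[OF rate_pos])
      (simp only: sum.atLeast1_atMost_eq One_nat_def weight_Suc)
  \<comment> \<open>Terms of a convergent series vanish, so (b) implies the weaker condition and
    both alternatives of (2) reduce to it.\<close>
  have weight: "rmda_weight \<eta> \<longlonglongrightarrow> 0" if "summable (\<lambda>t. (rmda_weight \<eta> t)\<^sup>2)"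
    using summable_LIMSEQ_zero[OF that] by simp
  have "mean_loss D f differentiable (at w)" for w
    using D.GDERIV_mean_loss[of w] by (auto simp: gderiv_def differentiable_def)
  moreover have "L-lipschitz_on UNIV (grad (mean_loss D f))"
    unfolding D.grad_mean_loss by (rule D.mean_gradient_lipschitz)
  ultimately show ?thesis
  proof (intro conjI impI allI)
    assume slow: "filterlim (\<lambda>n. \<Sum>t=1..n. rmda_weight \<eta> t) at_top sequentially \<and>
      (AE \<omega> in M. (\<lambda>t. norm (W (t + 1) \<omega> - W t \<omega>) / rmda_weight \<eta> t) \<longlonglongrightarrow> 0)"
    show "AE \<omega> in M. (\<lambda>t. rmda_error \<eta> (mean_loss D f) V W t \<omega>) \<longlonglongrightarrow> 0"
      if "summable (\<lambda>t. (rmda_weight \<eta> t)\<^sup>2)"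
      using slow by (intro AE_error_vanishes[OF div _ weight[OF that] that]) simp_all
    show "(\<lambda>t. \<integral>\<^sup>+ \<omega>. ennreal ((norm (rmda_error \<eta> (mean_loss D f) V W t \<omega>))\<^sup>2) \<partial>M) \<longlonglongrightarrow> 0"
      if "(\<exists>K. bounded K \<and> (AE \<omega> in M. \<forall>t. W t \<omega> \<in> K)) \<and>
        (summable (\<lambda>t. (rmda_weight \<eta> t)\<^sup>2) \<or> rmda_weight \<eta> \<longlonglongrightarrow> 0)"
    proof -
      from that obtain K where "bounded K" "AE \<omega> in M. \<forall>t. W t \<omega> \<in> K"
        by blast
      moreover have "rmda_weight \<eta> \<longlonglongrightarrow> 0"
        using that weight by blast
      ultimately show ?thesis
        using slow by (intro error_second_moment_vanishes[OF div]) simp_all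
    qed
  qed
qed

end
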